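(* For every positive integer $w$, the class of (finite) graphs of layered treewidth at most $w$ has asymptotic dimension at most $2$.
   Context: All graphs are finite and simple. A graph $G$ is regarded as the metric space $(V(G),d_G)$ with $d_G$ the shortest-path distance ($\infty$ between different components). For a (pseudo)metric space $(X,d)$, a family $\mathcal U$ of subsets of $X$ is $D$-bounded if each member has diameter at most $D$, and $r$-disjoint if $d(a,b)>r$ whenever $a,b$ lie in different members. A function $D_X:\mathbb{R}^+\to\mathbb{R}^+$ is an $n$-dimensional control function for $(X,d)$ if for every $r>0$ there is a cover $\mathcal U=\bigcup_{i=1}^{n+1}\mathcal U_i$ of $X$ with each $\mathcal U_i$ $r$-disjoint and each member of $\mathcal U$ $D_X(r)$-bounded. The asymptotic dimension of a family of spaces is the least $n$ for which a single function is an $n$-dimensional control function for every member. A tree-decomposition of $G$ is a pair $(T,(X_t)_{t\in V(T)})$ with $T$ a tree and $X_t\subseteq V(G)$ (bags) such that $\bigcup_t X_t=V(G)$, every edge has both ends in some bag, and for each vertex $v$ the set $\{t: v\in X_t\}$ induces a connected subtree. A layering of $G$ is an ordered partition $(V_i)_{i\in\mathbb N}$ or $(V_i)_{i\in\mathbb Z}$ of $V(G)$ into possibly empty sets (layers) such that every edge has both ends in $V_i\cup V_{i+1}$ for some $i$. The layered treewidth of $G$ is the minimum $w$ such that there exist a tree-decomposition and a layering of $G$ with every bag meeting every layer in at most $w$ vertices. *)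

theory Defs
  imports "Graph_Theory.Graph_Theory" "HOL-Library.Extended_Nat"
begin

section \<open>Asymptotic dimension of a family of spaces\<close>

text \<open>
  A space is a carrier together with a distance taking values in \<^typ>\<open>ereal\<close>, because the
  shortest-path distance is infinite between different components.
\<close>

type_synonym 'a space = "'a set \<times> ('a \<Rightarrow> 'a \<Rightarrow> ereal)"

definition set_diameter :: "('a \<Rightarrow> 'a \<Rightarrow> ereal) \<Rightarrow> 'a set \<Rightarrow> ereal" where
  "set_diameter d A = (SUP (a, b)\<in>A \<times> A. d a b)"

definition bounded_family :: "('a \<Rightarrow> 'a \<Rightarrow> ereal) \<Rightarrow> real \<Rightarrow> 'a set set \<Rightarrow> bool" where
  "bounded_family d D \<U> \<longleftrightarrow> (\<forall>A\<in>\<U>. set_diameter d A \<le> ereal D)"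

definition disjoint_family_at :: "('a \<Rightarrow> 'a \<Rightarrow> ereal) \<Rightarrow> real \<Rightarrow> 'a set set \<Rightarrow> bool" where
  "disjoint_family_at d r \<U> \<longleftrightarrow>
     (\<forall>A\<in>\<U>. \<forall>B\<in>\<U>. A \<noteq> B \<longrightarrow> (\<forall>a\<in>A. \<forall>b\<in>B. d a b > ereal r))"

text \<open>
  A function \<open>\<real>\<^sup>+ \<rightarrow> \<real>\<^sup>+\<close> is a function on \<^typ>\<open>real\<close> that is positive at positive
  arguments; its values elsewhere are irrelevant.
\<close>

definition control_function :: "nat \<Rightarrow> 'a space \<Rightarrow> (real \<Rightarrow> real) \<Rightarrow> bool" where
  "control_function n S D \<longleftrightarrow> (case S of (X, d) \<Rightarrow>
     (\<forall>r>0. D r > 0 \<and>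
       (\<exists>\<U> :: nat \<Rightarrow> 'a set set.
          \<Union>(\<Union>i\<in>{1..n+1}. \<U> i) = X \<and>
          (\<forall>i\<in>{1..n+1}. disjoint_family_at d r (\<U> i)) \<and>
          bounded_family d (D r) (\<Union>i\<in>{1..n+1}. \<U> i))))"

text \<open>The value is \<open>\<infinity>\<close> (infimum of the empty set) if there is no such \<open>n\<close>.\<close>

definition asymptotic_dimension :: "'a space set \<Rightarrow> enat" where
  "asymptotic_dimension \<F> = Inf {enat n | n. \<exists>D. \<forall>S\<in>\<F>. control_function n S D}"

section \<open>Graphs\<close>

text \<open>
  A finite simple graph is a \<^const>\<open>pair_graph\<close>: a finite vertex set with a symmetric
  irreflexive set of arcs, each edge being represented by its two orientations. The
  shortest-path distance is the infimum of the costs of all walks when each arc costs 1.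
  The vertex type is arbitrary; over \<^typ>\<open>nat\<close> every finite graph occurs up to isomorphism.
\<close>

definition graph_space :: "'a pair_pre_digraph \<Rightarrow> 'a space" where
  "graph_space G = (pverts G, wf_digraph.\<mu> (with_proj G) (\<lambda>_. 1))"

text \<open>
  The library's \<^const>\<open>tree\<close> is unsuitable for graphs represented as symmetric digraphs: its
  notion of cycle includes walking along an edge and back. The cycles of a simple graph are
  those of length at least 3. For symmetric digraphs, strong connectedness is connectedness
  (and includes non-emptiness).
\<close>

definition graph_tree :: "'t pair_pre_digraph \<Rightarrow> bool" where
  "graph_tree T \<longleftrightarrow> pair_graph T \<and> strongly_connected (with_proj T) \<and>
     \<not> (\<exists>p. pre_digraph.cycle (with_proj T) p \<and> length p \<ge> 3)"

definition tree_decomposition ::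
  "'a pair_pre_digraph \<Rightarrow> 't pair_pre_digraph \<Rightarrow> ('t \<Rightarrow> 'a set) \<Rightarrow> bool" where
  "tree_decomposition G T X \<longleftrightarrow>
     graph_tree T \<and>
     (\<forall>t\<in>pverts T. X t \<subseteq> pverts G) \<and>
     (\<Union>t\<in>pverts T. X t) = pverts G \<and>
     (\<forall>(u, v)\<in>parcs G. \<exists>t\<in>pverts T. u \<in> X t \<and> v \<in> X t) \<and>
     (\<forall>v\<in>pverts G. strongly_connected (with_proj T \<restriction> {t\<in>pverts T. v \<in> X t}))"

text \<open>Layerings are indexed by \<open>\<nat>\<close> or by \<open>\<int>\<close>, hence the polymorphic index type.\<close>

definition layering :: "'a pair_pre_digraph \<Rightarrow> ('i::semiring_1 \<Rightarrow> 'a set) \<Rightarrow> bool" where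
  "layering G L \<longleftrightarrow>
     (\<Union>i. L i) = pverts G \<and>
     (\<forall>i j. i \<noteq> j \<longrightarrow> L i \<inter> L j = {}) \<and>
     (\<forall>(u, v)\<in>parcs G. \<exists>i. u \<in> L i \<union> L (i + 1) \<and> v \<in> L i \<union> L (i + 1))"

definition layered_width_at_most ::
  "'t pair_pre_digraph \<Rightarrow> ('t \<Rightarrow> 'a set) \<Rightarrow> ('i \<Rightarrow> 'a set) \<Rightarrow> nat \<Rightarrow> bool" where
  "layered_width_at_most T X L w \<longleftrightarrow> (\<forall>t\<in>pverts T. \<forall>i. card (X t \<inter> L i) \<le> w)"

text \<open>
  Trees are finite, so taking their nodes in \<^typ>\<open>nat\<close> loses nothing.
\<close>

definition has_layered_width :: "'a pair_pre_digraph \<Rightarrow> nat \<Rightarrow> bool" where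
  "has_layered_width G w \<longleftrightarrow>
     (\<exists>(T :: nat pair_pre_digraph) X. tree_decomposition G T X \<and>
        ((\<exists>L :: nat \<Rightarrow> 'a set. layering G L \<and> layered_width_at_most T X L w) \<or>
         (\<exists>L :: int \<Rightarrow> 'a set. layering G L \<and> layered_width_at_most T X L w)))"

definition layered_treewidth :: "'a pair_pre_digraph \<Rightarrow> nat" where
  "layered_treewidth G = (LEAST w. has_layered_width G w)"

text \<open>The minimum exists: use a single bag and a single layer.\<close>

lemma has_layered_width_card:
  assumes "pair_graph G"
  shows "has_layered_width G (card (pverts G))"
proof -
  interpret G: pair_graph G by fact
  define T :: "nat pair_pre_digraph" where "T = \<lparr>pverts = {0}, parcs = {}\<rparr>"
  define X :: "nat \<Rightarrow> 'a set" where "X = (\<lambda>_. pverts G)"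
  define L :: "nat \<Rightarrow> 'a set" where "L = (\<lambda>i. if i = 0 then pverts G else {})"
  have pg: "pair_graph T"
    by unfold_locales (auto simp: T_def symmetric_def arcs_ends_def with_proj_def sym_def)
  have conn: "strongly_connected (with_proj T)"
    by (auto simp: strongly_connected_def T_def with_proj_def reachable_def intro: rtrancl_on_refl)
  have sub: "with_proj T \<restriction> {t \<in> pverts T. v \<in> X t} = with_proj T" if "v \<in> pverts G" for v
    using that by (auto simp: T_def with_proj_def induce_subgraph_def X_def)
  have conn': "\<forall>v\<in>pverts G. strongly_connected (with_proj T \<restriction> {t \<in> pverts T. v \<in> X t})"
    using conn sub by simp
  have nocyc: "\<not> pre_digraph.cycle (with_proj T) p" for p
    by (auto simp: pre_digraph.cycle_def pre_digraph.awalk_def T_def with_proj_def)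
  have "tree_decomposition G T X"
    unfolding tree_decomposition_def graph_tree_def
    using nocyc
    by (intro conjI pg conn conn')
      (auto simp: X_def T_def dest: G.arc_fst_in_verts G.arc_snd_in_verts)
  moreover have "layering G L"
    unfolding layering_def
    by (auto simp: L_def split: if_splits dest: G.arc_fst_in_verts G.arc_snd_in_verts)
  moreover have "layered_width_at_most T X L (card (pverts G))"
    by (auto simp: layered_width_at_most_def X_def L_def)
  ultimately show ?thesis
    unfolding has_layered_width_def by blast
qed

lemma layered_treewidth_le_iff:
  assumes "pair_graph G"
  shows "layered_treewidth G \<le> w \<longleftrightarrow> has_layered_width G w"
proof
  assume le: "layered_treewidth G \<le> w"
  have "has_layered_width G (layered_treewidth G)"
    unfolding layered_treewidth_def by (rule LeastI) (rule has_layered_width_card[OF assms])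
  with le show "has_layered_width G w"
    unfolding has_layered_width_def layered_width_at_most_def by (meson le_trans)
next
  assume "has_layered_width G w"
  then show "layered_treewidth G \<le> w"
    unfolding layered_treewidth_def by (rule Least_le)
qed

end

theory Submission
  imports Defs
begin

text \<open>
  Bounded treewidth gives two colours at every scale \<open>r\<close>, by induction on the bag size. Cut the
  rooted tree greedily into pieces: starting at a piece root \<open>q\<close>, a node below stays in the
  piece as long as its bag meets the ball of radius \<open>5 r\<close> around the bag \<open>X q\<close>. Inside a piece,
  deleting that ball decreases all bags, so the induction hypothesis colours the rest of the piece
  at a larger scale; and everything close to the few vertices of \<open>X q\<close> is harmless, since
  chains near boundedly many points are bounded. Three bands around \<open>X q\<close> (one copying the colours
  of the adhesion to the parent piece, one of either colour) stop monochromatic chains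
  from running through more than two consecutive pieces.

  For layered treewidth, cut the layers into blocks. Every thickened block has bounded treewidth,
  hence a 2-colouring. Block \<open>m\<close> uses the colours \<open>m\<close> and \<open>m + 1\<close> modulo 3, so that a monochromatic
  chain lives in two consecutive blocks, one even and one odd; taking the scale
  in odd blocks large compared with the diameters in even blocks keeps such chains bounded.
\<close>

section \<open>Distances in induced subgraphs\<close>

text \<open>The rule \<open>refl\<close> holds for every \<open>n\<close>, so \<open>n\<close> is an
  upper bound for the length of a walk that stays inside \<open>A\<close>: distances are those of
  the subgraph induced by \<open>A\<close>.\<close>

inductive dist_le :: "('a \<times> 'a) set \<Rightarrow> 'a set \<Rightarrow> nat \<Rightarrow> 'a \<Rightarrow> 'a \<Rightarrow> bool"
  for E :: "('a \<times> 'a) set" and A :: "'a set" where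
  refl: "u \<in> A \<Longrightarrow> dist_le E A n u u"
| step: "dist_le E A n u v \<Longrightarrow> (v, w) \<in> E \<Longrightarrow> w \<in> A \<Longrightarrow> dist_le E A (Suc n) u w"

lemma dist_le_in:
  assumes "dist_le E A n u v"
  shows "u \<in> A" "v \<in> A"
  using assms by (induction) auto

lemma dist_le_mono:
  assumes "dist_le E A n u v" "n \<le> m"
  shows "dist_le E A m u v"
  using assms
proof (induction arbitrary: m)
  case (step n u v w)
  then obtain m' where "m = Suc m'" "n \<le> m'" by (cases m) auto
  with step show ?case by (auto intro: dist_le.step)
qed (auto intro: dist_le.refl)

lemma dist_le_subset:
  assumes "dist_le E A n u v" "A \<subseteq> B"
  shows "dist_le E B n u v"
  using assms by (induction) (auto intro: dist_le.intros)

lemma dist_le_trans: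
  assumes "dist_le E A m u v" "dist_le E A n v w"
  shows "dist_le E A (m + n) u w"
  using assms(2,1)
  by (induction) (auto intro: dist_le.step elim: dist_le_mono)

lemma dist_le_edge:
  assumes "(u, v) \<in> E" "u \<in> A" "v \<in> A"
  shows "dist_le E A (Suc 0) u v"
  using assms by (auto intro: dist_le.intros)

lemma dist_le_sym:
  assumes "dist_le E A n u v" "sym E"
  shows "dist_le E A n v u"
  using assms
proof (induction)
  case (step n u v w)
  then have "dist_le E A (Suc 0) w v"
    by (auto intro!: dist_le_edge dest: symD dist_le_in)
  from dist_le_trans[OF this] step show ?case by simp
qed (auto intro: dist_le.refl)

lemma dist_le_relpow:
  assumes "(u, v) \<in> R ^^ n" "u \<in> A" "\<And>x y. (x, y) \<in> R \<Longrightarrow> dist_le E A l x y"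
  shows "dist_le E A (n * l) u v"
  using assms(1)
proof (induction n arbitrary: v)
  case (Suc n)
  then obtain w where "(u, w) \<in> R ^^ n" "(w, v) \<in> R" by auto
  from dist_le_trans[OF Suc.IH[OF this(1)] assms(3)[OF this(2)]]
  show ?case by (simp add: add.commute)
qed (auto intro: dist_le.refl assms)

text \<open>Either the walk itself avoids \<open>F\<close>, or it has a vertex in \<open>F\<close>,
  and a vertex on a walk is within the length of the walk from both ends.\<close>

lemma dist_le_avoid:
  assumes "dist_le E A n u v" "sym E"
  shows "dist_le E (A - F) n u v \<or> (\<exists>z\<in>F. dist_le E A n z u \<and> dist_le E A n z v)"
  using assms
proof (induction)
  case (refl u n)
  then show ?case by (cases "u \<in> F") (auto intro: dist_le.refl)
next
  case (step n u v w)
  have uw: "dist_le E A (Suc n) u w" using step by (auto intro: dist_le.step)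
  show ?case
  proof (cases "w \<in> F")
    case True
    then show ?thesis using step uw by (meson dist_le.refl dist_le_sym)
  next
    case False
    from step consider "dist_le E (A - F) n u v"
      | z where "z \<in> F" "dist_le E A n z u" "dist_le E A n z v" by auto
    then show ?thesis
    proof cases
      case 1
      then show ?thesis using step False by (auto intro: dist_le.step)
    next
      case 2
      then show ?thesis using step
        by (auto intro!: disjI2 bexI[of _ z] intro: dist_le.step elim: dist_le_mono)
    qed
  qed
qed

text \<open>Some edge of the walk turns \<open>P\<close> from true to false; the far end of that
  edge serves as \<open>z\<close>.\<close>

lemma dist_le_cross:
  assumes "dist_le E A n u v" "sym E" "P u" "\<not> P v"
    "\<And>x y. (x, y) \<in> E \<Longrightarrow> P x \<Longrightarrow> \<not> P y \<Longrightarrow> y \<in> Z"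
  shows "\<exists>z\<in>Z. dist_le E A n z u \<and> dist_le E A n z v"
  using assms
proof (induction)
  case (step n u v w)
  have uw: "dist_le E A (Suc n) u w" using step by (auto intro: dist_le.step)
  show ?case
  proof (cases "P v")
    case True
    then have "w \<in> Z" using step by blast
    then show ?thesis using step uw by (meson dist_le.refl dist_le_sym)
  next
    case False
    with step obtain z where "z \<in> Z" "dist_le E A n z u" "dist_le E A n z v" by blast
    then show ?thesis using step
      by (auto intro!: bexI[of _ z] intro: dist_le.step elim: dist_le_mono)
  qed
qed auto

text \<open>Every vertex of the walk is itself within \<open>n\<close> of \<open>u\<close>, so the
  whole walk lies in \<open>B\<close>.\<close>

lemma dist_le_restrict:
  assumes "dist_le E A n u v" "\<And>z. dist_le E A n u z \<Longrightarrow> z \<in> B"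
  shows "dist_le E B n u v"
  using assms
proof (induction)
  case (step n u v w)
  have "dist_le E B n u v"
    by (rule step.IH, rule step.prems, erule dist_le_mono) simp
  moreover have "w \<in> B" using step by (auto intro: dist_le.step)
  ultimately show ?case using step.hyps by (auto intro: dist_le.step)
qed (auto intro: dist_le.refl)

section \<open>Balls around a set, and chains that stay near few points\<close>

definition near :: "('a \<times> 'a) set \<Rightarrow> 'a set \<Rightarrow> 'a set \<Rightarrow> nat \<Rightarrow> 'a set" where
  "near E A B m = {v. \<exists>b\<in>B. dist_le E A m b v}"

lemma near_mono: "m \<le> n \<Longrightarrow> near E A B m \<subseteq> near E A B n"
  by (auto simp: near_def elim: dist_le_mono)

lemma near_step:
  "x \<in> near E A B m \<Longrightarrow> dist_le E A n x y \<Longrightarrow> y \<in> near E A B (m + n)"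
  by (auto simp: near_def intro: dist_le_trans)

lemma near_superset: "B \<subseteq> B' \<Longrightarrow> near E A B m \<subseteq> near E A B' m"
  by (auto simp: near_def)

lemma near_subset: "near E A B m \<subseteq> A"
  by (auto simp: near_def dest: dist_le_in)

lemma near_self: "b \<in> B \<Longrightarrow> b \<in> A \<Longrightarrow> b \<in> near E A B m"
  by (auto simp: near_def intro: dist_le.refl)

definition chain_near :: "('a \<times> 'a) set \<Rightarrow> 'a set \<Rightarrow> 'a set \<Rightarrow> nat \<Rightarrow> nat \<Rightarrow> ('a \<times> 'a) set" where
  "chain_near E A B m l = {(x, y). x \<in> near E A B m \<and> y \<in> near E A B m \<and> dist_le E A l x y}"

text \<open>Here \<open>2 * m\<close> joins the two ends of a chain to centres, and
  \<open>k * k\<close> bounds the number of pairs of centres, hence of steps in a shortened chain of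
  centres; each such step has length \<open>2 * m + l\<close>.\<close>

definition cluster :: "nat \<Rightarrow> nat \<Rightarrow> nat \<Rightarrow> nat" where
  "cluster k m l = 2 * m + k * k * (2 * m + l)"

text \<open>A chain staying near \<open>B\<close> is shadowed by a chain in \<open>B\<close>, which can be shortened to
  at most \<open>|B|\<^sup>2\<close> steps.\<close>

lemma chain_near_bounded:
  assumes B: "finite B" "card B \<le> k" and E: "sym E"
    and x: "x \<in> near E A B m" and xy: "(x, y) \<in> (chain_near E A B m l)\<^sup>*"
  shows "dist_le E A (cluster k m l) x y"
proof -
  define R where "R = {(b, b'). b \<in> B \<and> b' \<in> B \<and> dist_le E A (2 * m + l) b b'}"
  obtain b where b: "b \<in> B" "dist_le E A m b x" using x by (auto simp: near_def)
  have sub: "R \<subseteq> B \<times> B" by (auto simp: R_def)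
  have fin: "finite R" by (rule finite_subset[OF sub]) (use B in auto)
  have "\<exists>b'\<in>B. dist_le E A m b' y \<and> (b, b') \<in> R\<^sup>*"
    using xy
  proof (induction)
    case base
    then show ?case using b by auto
  next
    case (step y z)
    then obtain b' b'' where b': "b' \<in> B" "dist_le E A m b' y" "(b, b') \<in> R\<^sup>*"
      and b'': "b'' \<in> B" "dist_le E A m b'' z" "dist_le E A l y z"
      by (auto simp: chain_near_def near_def)
    have "dist_le E A (m + l + m) b' b''"
      using dist_le_trans[OF dist_le_trans[OF b'(2) b''(3)] dist_le_sym[OF b''(2) E]] .
    moreover have "m + l + m = 2 * m + l" by simp
    ultimately have "(b', b'') \<in> R" using b' b'' by (simp add: R_def)
    then show ?case using b' b'' by (meson rtrancl_into_rtrancl)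
  qed
  then obtain b' where b': "b' \<in> B" "dist_le E A m b' y" "(b, b') \<in> R\<^sup>*" by blast
  then obtain n where n: "n \<le> card R" "(b, b') \<in> R ^^ n"
    by (auto simp: rtrancl_finite_eq_relpow[OF fin])
  have "card R \<le> card (B \<times> B)" by (rule card_mono[OF _ sub]) (use B in auto)
  also have "\<dots> \<le> k * k" using B by (auto simp: card_cartesian_product intro: mult_mono)
  finally have "n \<le> k * k" using n by simp
  moreover have "dist_le E A (n * (2 * m + l)) b b'"
    by (rule dist_le_relpow[OF n(2)]) (use b in \<open>auto simp: R_def dest: dist_le_in\<close>)
  ultimately have "dist_le E A (k * k * (2 * m + l)) b b'"
    by (elim dist_le_mono) simp
  from dist_le_trans[OF dist_le_trans[OF dist_le_sym[OF b(2) E] this] b'(2)]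
  show ?thesis by (simp add: cluster_def algebra_simps)
qed

section \<open>Colourings with bounded monochromatic chains\<close>

definition mono_step :: "('a \<times> 'a) set \<Rightarrow> 'a set \<Rightarrow> 'a set \<Rightarrow> nat \<Rightarrow> ('a \<Rightarrow> 'c) \<Rightarrow> ('a \<times> 'a) set" where
  "mono_step E A H r c = {(x, y). x \<in> H \<and> y \<in> H \<and> c x = c y \<and> dist_le E A r x y}"

text \<open>Chains visit only \<open>H\<close>, but distances are measured in \<open>A\<close>; this
  is a bound on the weak diameter.\<close>

definition bounded_colouring ::
  "('a \<times> 'a) set \<Rightarrow> 'a set \<Rightarrow> 'a set \<Rightarrow> nat \<Rightarrow> nat \<Rightarrow> ('a \<Rightarrow> 'c) \<Rightarrow> bool" where
  "bounded_colouring E A H r D c \<longleftrightarrow>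
     (\<forall>x\<in>H. \<forall>y. (x, y) \<in> (mono_step E A H r c)\<^sup>* \<longrightarrow> dist_le E A D x y)"

lemma sym_mono_step: "sym E \<Longrightarrow> sym (mono_step E A H r c)"
  by (auto simp: mono_step_def intro!: symI intro: dist_le_sym)

lemma mono_step_rtranclD:
  assumes "(x, y) \<in> (mono_step E A H r c)\<^sup>*" "x \<in> H"
  shows "y \<in> H" "c y = c x"
  using assms by (induction) (auto simp: mono_step_def)

text \<open>Cut the chain after its last step that is not in \<open>P\<close>; that step ends in
  \<open>N\<close>.\<close>

lemma rtrancl_split_near:
  assumes xy: "(x, y) \<in> R\<^sup>*"
    and step: "\<And>a b. (a, b) \<in> R \<Longrightarrow> (a, b) \<in> P \<or> (a \<in> N \<and> b \<in> N)"
  shows "(x, y) \<in> P\<^sup>* \<or> (\<exists>g\<in>N. (x, g) \<in> R\<^sup>* \<and> (g, y) \<in> P\<^sup>*)"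
  using xy
proof (induction)
  case (step y z)
  then show ?case
    using assms(2)[of y z] by (meson rtrancl.simps rtrancl_into_rtrancl)
qed auto

text \<open>Well-founded recursion along \<open>p\<close> in existential form, since
  \<open>rho\<close> and the colouring have to be built recursively in the middle of an
  induction.\<close>

lemma ex_recursive_function:
  fixes m :: "'a \<Rightarrow> nat"
  assumes "\<And>v. inh v \<Longrightarrow> m (p v) < m v"
  shows "\<exists>f. \<forall>v. f v = (if inh v then g v (f (p v)) else b v)"
proof -
  define F where "F f v = (if inh v then g v (f (p v)) else b v)" for f v
  have "wfrec (measure m) F v = F (wfrec (measure m) F) v" for v
    by (subst wfrec[OF wf_measure]) (use assms in \<open>auto simp: F_def cut_apply\<close>)
  then show ?thesis unfolding F_def by blast
qed

section \<open>Rooted tree-decompositions and pieces\<close>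

text \<open>The tree is given by a parent map and a measure \<open>dep\<close> that decreases
  upwards. The node \<open>top v\<close> is the highest one whose bag has \<open>v\<close>;
  \<open>bag_par\<close> says that the nodes of \<open>v\<close> form a subtree, as \<open>v\<close>
  persists in parent bags until \<open>top v\<close> is reached.\<close>

locale rooted_tree_decomposition =
  fixes E :: "('a \<times> 'a) set" and T :: "'t set" and root :: 't and par :: "'t \<Rightarrow> 't"
    and dep :: "'t \<Rightarrow> nat" and X :: "'t \<Rightarrow> 'a set" and top :: "'a \<Rightarrow> 't"
  assumes sym_E: "sym E"
    and par: "t \<in> T \<Longrightarrow> t \<noteq> root \<Longrightarrow> par t \<in> T \<and> dep (par t) < dep t"
    and top_in: "t \<in> T \<Longrightarrow> v \<in> X t \<Longrightarrow> top v \<in> T \<and> v \<in> X (top v)"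
    and bag_par: "t \<in> T \<Longrightarrow> v \<in> X t \<Longrightarrow> t \<noteq> top v \<Longrightarrow> t \<noteq> root \<and> v \<in> X (par t)"
    and edge_in_bag: "(u, v) \<in> E \<Longrightarrow> \<exists>t\<in>T. u \<in> X t \<and> v \<in> X t"
begin

inductive desc :: "'t \<Rightarrow> 't \<Rightarrow> bool" for q where
  self: "q \<in> T \<Longrightarrow> desc q q"
| child: "t \<in> T \<Longrightarrow> t \<noteq> root \<Longrightarrow> desc q (par t) \<Longrightarrow> desc q t"

lemma desc_trans:
  assumes "desc p q" "desc q t"
  shows "desc p t"
  using assms(2,1) by (induction) (auto intro: desc.child)

lemma desc_par: "t \<in> T \<Longrightarrow> t \<noteq> root \<Longrightarrow> desc (par t) t"
  using par by (auto intro: desc.intros)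

lemma desc_cases: "desc q t \<Longrightarrow> t = q \<or> t \<noteq> root \<and> desc q (par t)"
  by (auto elim: desc.cases)

lemma desc_dep:
  assumes "desc q t"
  shows "dep q \<le> dep t" "t \<noteq> q \<Longrightarrow> dep q < dep t"
proof -
  have "t = q \<or> dep q < dep t" using assms
    by (induction) (use par in \<open>auto intro: less_trans\<close>)
  then show "dep q \<le> dep t" "t \<noteq> q \<Longrightarrow> dep q < dep t" by auto
qed

lemma top_desc: "t \<in> T \<Longrightarrow> v \<in> X t \<Longrightarrow> desc (top v) t"
proof (induction "dep t" arbitrary: t rule: less_induct)
  case less
  show ?case
  proof (cases "t = top v")
    case True
    then show ?thesis using less.prems by (auto intro: desc.self)
  next
    case False
    then have "t \<noteq> root" "v \<in> X (par t)" using bag_par less.prems by auto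
    then show ?thesis using less par[of t] by (auto intro: desc.child)
  qed
qed

lemma desc_bag: "desc q (top v) \<Longrightarrow> t \<in> T \<Longrightarrow> v \<in> X t \<Longrightarrow> desc q t"
  using top_desc desc_trans by blast

text \<open>Going up from \<open>t\<close>, the vertex \<open>v\<close> stays in the bags until
  \<open>top v\<close>, which is not met at or below \<open>q\<close>; so \<open>v\<close> survives
  into \<open>X q\<close> and the bag above.\<close>

lemma not_desc_top:
  assumes "desc q t" "v \<in> X t" "\<not> desc q (top v)"
  shows "v \<in> X q \<inter> X (par q)"
  using assms
proof (induction)
  case self
  then show ?case using bag_par[of q v] by (auto intro: desc.self)
next
  case (child t)
  then have "t \<noteq> top v" by (auto intro: desc.child)
  then show ?case using child bag_par[of t v] by auto
qed

text \<open>An edge that leaves the part below \<open>q\<close> has both ends in one bag, and this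
  bag lies below \<open>q\<close>; its outer end is therefore in the adhesion set of
  \<open>q\<close>.\<close>

lemma dist_le_cross_adhesion:
  assumes "dist_le E A n u v" "desc q (top u)" "\<not> desc q (top v)"
  shows "\<exists>z\<in>X q \<inter> X (par q) \<inter> A. dist_le E A n z u \<and> dist_le E A n z v"
proof -
  have "y \<in> X q \<inter> X (par q)"
    if xy: "(x, y) \<in> E" "desc q (top x)" "\<not> desc q (top y)" for x y
  proof -
    obtain t where "t \<in> T" "x \<in> X t" "y \<in> X t" using edge_in_bag xy by blast
    then show ?thesis using xy desc_bag not_desc_top by blast
  qed
  then have "\<exists>z\<in>X q \<inter> X (par q). dist_le E A n z u \<and> dist_le E A n z v"
    by (rule dist_le_cross[where P = "\<lambda>v. desc q (top v)", OF assms(1) sym_E assms(2,3)])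
  then show ?thesis by (auto dest: dist_le_in)
qed

end

text \<open>The node \<open>rho t\<close> is the root of the piece that contains \<open>t\<close>; nodes outside \<open>S\<close> get the
  junk value \<open>s\<close>, which is right for vertices whose topmost bag lies above \<open>S\<close>.\<close>

locale subtree_pieces = rooted_tree_decomposition +
  fixes A :: "'a set" and S :: "'b set" and s :: 'b and k r :: nat and rho :: "'b \<Rightarrow> 'b"
  assumes s_in: "s \<in> S" and S_sub: "S \<subseteq> T"
    and S_par: "t \<in> S \<Longrightarrow> t \<noteq> s \<Longrightarrow> t \<noteq> root \<and> par t \<in> S"
    and bags: "t \<in> S \<Longrightarrow> finite (X t \<inter> A) \<and> card (X t \<inter> A) \<le> Suc k"
    and rho: "rho t = (if t \<in> S \<and> t \<noteq> s
      then (if X t \<inter> near E A (X (rho (par t)) \<inter> A) (5 * r) = {} then t else rho (par t))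
      else s)"
begin

definition ball :: "'b \<Rightarrow> 'a set" where
  "ball q = near E A (X q \<inter> A) (5 * r)"

text \<open>Only these vertices need bounded chains; the other vertices of \<open>A\<close> still
  serve as intermediate points of walks.\<close>

definition H :: "'a set" where
  "H = A \<inter> (\<Union>t\<in>S. X t)"

definition piece :: "'b \<Rightarrow> bool" where
  "piece q \<longleftrightarrow> q \<in> S \<and> rho q = q"

definition child_piece :: "'b \<Rightarrow> 'b \<Rightarrow> bool" where
  "child_piece q p \<longleftrightarrow> piece q \<and> q \<noteq> s \<and> rho (par q) = p"

text \<open>Empty for \<open>s\<close>, because every vertex of \<open>H\<close> counts as inside
  the piece of \<open>s\<close> or below it, so that no chain enters from above.\<close>

definition adh :: "'b \<Rightarrow> 'a set" where
  "adh q = (if q = s then {} else X q \<inter> X (par q) \<inter> A)"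

lemma dep_par: "t \<in> S \<Longrightarrow> t \<noteq> s \<Longrightarrow> dep (par t) < dep t"
  using S_par par S_sub by blast

lemma S_induct [consumes 1, case_names root step]:
  assumes "t \<in> S" "P s" "\<And>t. t \<in> S \<Longrightarrow> t \<noteq> s \<Longrightarrow> P (par t) \<Longrightarrow> P t"
  shows "P t"
  using assms(1)
proof (induction "dep t" arbitrary: t rule: less_induct)
  case less
  then show ?case using assms dep_par S_par by (cases "t = s") auto
qed

lemma desc_S_par: "t \<in> S \<Longrightarrow> t \<noteq> s \<Longrightarrow> desc (par t) t"
  using desc_par S_par S_sub by blast

lemma desc_s: "t \<in> S \<Longrightarrow> desc s t"
  by (induction rule: S_induct)
    (use s_in S_sub desc_S_par desc_trans in \<open>auto intro: desc.self\<close>)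

lemma rho_s: "rho s = s"
  by (subst rho) simp

lemma rho_par: "t \<in> S \<Longrightarrow> rho t \<noteq> t \<Longrightarrow> t \<noteq> s \<and> rho (par t) = rho t \<and> X t \<inter> ball (rho t) \<noteq> {}"
  using rho[of t] rho_s by (auto simp: ball_def split: if_splits)

lemma piece_s: "piece s"
  by (simp add: piece_def s_in rho_s)

lemma piece_rho: "t \<in> S \<Longrightarrow> piece (rho t) \<and> desc (rho t) t"
proof (induction rule: S_induct)
  case root
  then show ?case using piece_s s_in S_sub by (auto simp: rho_s intro: desc.self)
next
  case (step t)
  then show ?case
    using rho_par[of t] desc_S_par[of t] desc_trans desc.self[of t] S_sub
    by (cases "rho t = t") (auto simp: piece_def)
qed

lemma rho_outside: "t \<notin> S \<Longrightarrow> rho t = s"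
  by (subst rho) simp

lemma child_piece_desc:
  assumes "child_piece q p"
  shows "piece p" "desc p (par q)" "desc p q" "dep p < dep q" "q \<noteq> p" "par q \<in> S" "q \<in> S"
proof -
  have q: "q \<in> S" "q \<noteq> s" "rho (par q) = p" using assms by (auto simp: child_piece_def piece_def)
  then show *: "piece p" "desc p (par q)" "par q \<in> S" "q \<in> S" using piece_rho S_par by auto
  show "desc p q" using * desc_S_par q desc_trans by blast
  show "dep p < dep q" using desc_dep(1)[OF *(2)] dep_par q by fastforce
  then show "q \<noteq> p" by auto
qed

text \<open>The parent of \<open>q\<close> is in the piece of \<open>p\<close> but \<open>q\<close>
  is not, so the greedy rule cut at \<open>q\<close>; it does so only if the bag misses the
  ball.\<close>

lemma child_piece_far:
  assumes "child_piece q p"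
  shows "X q \<inter> ball p = {}"
  using assms child_piece_desc(5)[OF assms] rho[of q]
  by (auto simp: child_piece_def piece_def ball_def split: if_splits)

text \<open>Going up from \<open>t\<close>, take the last piece root before the path enters the
  piece of \<open>q\<close>.\<close>

lemma ex_child_piece:
  assumes "t \<in> S" "piece q" "desc q t" "rho t \<noteq> q"
  shows "\<exists>q'. child_piece q' q \<and> desc q' t"
  using assms
proof (induction rule: S_induct)
  case root
  then have "desc s q" using desc_s by (auto simp: piece_def)
  then have "q = s" using root desc_dep by fastforce
  then show ?case using root by (simp add: rho_s)
next
  case (step t)
  have "t \<noteq> q" using step.prems by (auto simp: piece_def)
  then have par: "desc q (par t)" using desc_cases step.prems by blast
  show ?case
  proof (cases "rho (par t) = q")
    case True
    then have "child_piece t q"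
      using step rho_par[of t] by (auto simp: child_piece_def piece_def)
    then show ?thesis using step S_sub by (auto intro: desc.self)
  next
    case False
    then show ?thesis using step par desc_S_par desc_trans by blast
  qed
qed

text \<open>Going up inside \<open>S\<close> from a bag with \<open>v\<close>, the path either meets
  \<open>top v\<close> or arrives at \<open>s\<close> with \<open>v\<close> still in the
  bag.\<close>

lemma top_cases:
  assumes "v \<in> H"
  shows "top v \<in> S \<or> v \<in> X s \<and> dep (top v) < dep s"
proof -
  obtain t where "t \<in> S" "v \<in> X t" using assms by (auto simp: H_def)
  then show ?thesis
  proof (induction rule: S_induct)
    case root
    then have "desc (top v) s" using top_desc s_in S_sub by blast
    then show ?case using desc_dep(2) root s_in by metis
  next
    case (step t)
    then show ?case using bag_par[of t v] S_sub by (cases "t = top v") auto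
  qed
qed

lemma top_in_S:
  assumes "v \<in> H" "piece q" "desc q (top v)"
  shows "top v \<in> S"
proof (rule ccontr)
  assume "top v \<notin> S"
  then have "dep (top v) < dep s" using top_cases assms by blast
  also have "\<dots> \<le> dep q" using desc_s assms by (auto simp: piece_def intro: desc_dep)
  also have "\<dots> \<le> dep (top v)" using assms by (auto intro: desc_dep)
  finally show False by simp
qed

text \<open>Needed for \<open>cq (rho (top v))\<close> to say anything about \<open>v\<close>, as it
  controls only vertices in bags of the piece.\<close>

lemma piece_bag:
  assumes "v \<in> H"
  shows "\<exists>t\<in>S. rho t = rho (top v) \<and> v \<in> X t"
proof (cases "top v \<in> S")
  case True
  then show ?thesis using assms top_in S_sub by (auto simp: H_def)
next
  case False
  then have "rho (top v) = s" by (rule rho_outside)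
  then show ?thesis using False top_cases[OF assms] rho_s s_in by auto
qed

text \<open>The case \<open>q = s\<close> is separate because a vertex of \<open>H\<close> may have
  its topmost node above \<open>s\<close>.\<close>

definition inside :: "'b \<Rightarrow> 'a \<Rightarrow> bool" where
  "inside q v \<longleftrightarrow> q = s \<or> desc q (top v)"

lemma inside_child:
  assumes "v \<in> H" "piece q" "inside q v" "rho (top v) \<noteq> q"
  shows "\<exists>q'. child_piece q' q \<and> inside q' v"
proof -
  have "top v \<in> S"
  proof (cases "q = s")
    case True
    then show ?thesis using assms rho_outside[of "top v"] by auto
  qed (use assms top_in_S in \<open>auto simp: inside_def\<close>)
  moreover have "desc q (top v)" using assms desc_s calculation by (auto simp: inside_def)
  ultimately show ?thesis using ex_child_piece assms by (auto simp: inside_def)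
qed

lemma inside_child_desc: "child_piece q' q \<Longrightarrow> inside q' v \<longleftrightarrow> desc q' (top v)"
  by (auto simp: inside_def child_piece_def)

lemma cross_adh:
  assumes "child_piece q' q" "inside q' u" "\<not> inside q' v" "dist_le E A n u v"
  shows "\<exists>z\<in>adh q'. dist_le E A n z u \<and> dist_le E A n z v"
  using dist_le_cross_adhesion[OF assms(4), of q'] assms
  by (auto simp: inside_def child_piece_def adh_def)

text \<open>Otherwise \<open>v\<close> is below a child piece \<open>q'\<close>, and the short walk
  from \<open>X q\<close> to \<open>v\<close> crosses the adhesion set of \<open>q'\<close>. This
  puts a vertex of \<open>X q'\<close> into \<open>ball q\<close>, against
  \<open>child_piece_far\<close>.\<close>

lemma near_piece:
  assumes "v \<in> H" "piece q" "inside q v" "v \<in> ball q"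
  shows "rho (top v) = q"
proof (rule ccontr)
  assume "rho (top v) \<noteq> q"
  then obtain q' where q': "child_piece q' q" "inside q' v" using inside_child assms by blast
  obtain b where b: "b \<in> X q" "b \<in> A" "dist_le E A (5 * r) b v"
    using assms by (auto simp: ball_def near_def)
  have "\<not> inside q' b"
  proof
    assume "inside q' b"
    then have "desc q' (top b)" using inside_child_desc q' by blast
    then have "desc q' q" using desc_bag b assms S_sub by (auto simp: piece_def)
    then show False using child_piece_desc(4)[OF q'(1)] desc_dep(1) by fastforce
  qed
  then obtain z where z: "z \<in> adh q'" "dist_le E A (5 * r) z b"
    using cross_adh q' dist_le_sym[OF b(3) sym_E] by blast
  then have "z \<in> ball q"
    using b dist_le_sym[OF z(2) sym_E] by (auto simp: ball_def near_def)
  then show False using z child_piece_far[OF q'(1)] by (auto simp: adh_def split: if_splits)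
qed

lemma in_ball: "v \<in> X q \<Longrightarrow> v \<in> A \<Longrightarrow> v \<in> ball q"
  by (simp add: ball_def near_self)

lemma adh_sub: "adh q \<subseteq> X q \<inter> A"
  by (auto simp: adh_def)

text \<open>Going up from \<open>t\<close> within its piece, the path must meet \<open>top h\<close>
  before the piece root, whose bag lacks \<open>h\<close>.\<close>

lemma rho_top_eq:
  assumes "t \<in> S" "h \<in> X t" "h \<notin> X (rho t)"
  shows "rho (top h) = rho t"
  using assms
proof (induction rule: S_induct)
  case root
  then show ?case by (simp add: rho_s)
next
  case (step t)
  show ?case
  proof (cases "t = top h")
    case False
    then have "h \<in> X (par t)" using bag_par[of t h] step S_sub by auto
    moreover have "rho t \<noteq> t" using step by auto
    ultimately show ?thesis using step rho_par[of t] by auto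
  qed auto
qed

text \<open>The bag \<open>X q'\<close> misses \<open>ball q\<close>, so its adhesion vertices
  belong to the parent piece and are coloured there by \<open>cq q\<close>. This is what makes them
  usable as shadows.\<close>

lemma adh_hat:
  assumes "child_piece q' q" "h \<in> adh q'"
  shows "h \<in> H" "rho (top h) = q" "h \<notin> ball q"
proof -
  have h: "h \<in> X q'" "h \<in> X (par q')" "h \<in> A" using assms by (auto simp: adh_def child_piece_def)
  then show far: "h \<notin> ball q" using child_piece_far assms by blast
  show "h \<in> H" using h child_piece_desc[OF assms(1)] by (auto simp: H_def)
  have "rho (par q') = q" using assms by (auto simp: child_piece_def)
  then show "rho (top h) = q" using rho_top_eq[of "par q'" h] h far in_ball
      child_piece_desc[OF assms(1)] by auto
qed

end

section \<open>Two colours for bounded treewidth\<close>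

text \<open>Since the innermost band copies the colours of the adhesion set, a chain that enters a child
  piece can be shadowed in the parent piece. The bands \<open>False\<close> and \<open>True\<close> behind it stop
  chains of the opposite colour. The scale \<open>r'\<close> is chosen so that the shadow of an excursion into a
  child piece is a single step.\<close>

locale piece_colouring = subtree_pieces +
  fixes r' D' :: nat and c :: "'a \<Rightarrow> bool" and cq :: "'b \<Rightarrow> 'a \<Rightarrow> bool" and pi :: "'a \<Rightarrow> 'a"
  assumes r': "r' = cluster (Suc k) (3 * r) r + 4 * r"
    and cq: "piece q \<Longrightarrow> bounded_colouring E (A - ball q)
      ((A - ball q) \<inter> (\<Union>t\<in>{t \<in> S. rho t = q}. X t)) r' D' (cq q)"
    and c: "c v = (if v \<in> near E A (adh (rho (top v))) r then c (pi v)
      else if v \<in> near E A (X (rho (top v)) \<inter> A) (3 * r) then False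
      else if v \<in> ball (rho (top v)) then True else cq (rho (top v)) v)"
    and pi: "v \<in> near E A (adh (rho (top v))) r \<Longrightarrow>
      pi v \<in> adh (rho (top v)) \<and> dist_le E A r (pi v) v"
begin

abbreviation M :: "('a \<times> 'a) set" where
  "M \<equiv> mono_step E A H r c"

lemma sym_M: "sym M"
  by (rule sym_mono_step[OF sym_E])

lemma near_adh_sub: "m \<le> n \<Longrightarrow> near E A (adh q) m \<subseteq> near E A (X q \<inter> A) n"
  by (rule order_trans[OF near_superset[OF adh_sub] near_mono])

lemma near_sub_ball: "m \<le> 5 * r \<Longrightarrow> near E A (X q \<inter> A) m \<subseteq> ball q"
  unfolding ball_def by (rule near_mono)

text \<open>An invariant along the chain: an entering step lands within \<open>r\<close> of the
  adhesion set; from there the band \<open>False\<close> stops chains of colour \<open>True\<close>,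
  and the band \<open>True\<close> stops those of colour \<open>False\<close>.\<close>

lemma chain_inside:
  assumes "child_piece q' q" "x \<in> H" "\<not> inside q' x" "(x, y) \<in> M\<^sup>*" "inside q' y"
  shows "y \<in> near E A (X q' \<inter> A) (3 * r) \<and> (c y \<longrightarrow> y \<in> near E A (adh q') r)"
  using assms(4,5)
proof (induction)
  case base
  then show ?case using assms by simp
next
  case (step y z)
  have yz: "dist_le E A r y z" "c y = c z" "y \<in> H" "z \<in> H"
    using step by (auto simp: mono_step_def)
  have piece: "piece q'" using assms by (simp add: child_piece_def)
  show ?case
  proof (cases "inside q' y")
    case False
    from cross_adh[OF assms(1) step.prems False dist_le_sym[OF yz(1) sym_E]]
    have "z \<in> near E A (adh q') r" by (auto simp: near_def)
    then show ?thesis using near_adh_sub[of r "3 * r" q'] by auto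
  next
    case True
    with step have IH: "y \<in> near E A (X q' \<inter> A) (3 * r)" "c y \<longrightarrow> y \<in> near E A (adh q') r"
      by auto
    \<comment> \<open>Since \<open>4 * r\<close> is at most the radius \<open>5 * r\<close>,
      \<open>z\<close> has not jumped over the outer band.\<close>
    have "z \<in> near E A (X q' \<inter> A) (3 * r + r)" by (rule near_step[OF IH(1) yz(1)])
    then have z: "z \<in> ball q'" using near_sub_ball[of "3 * r + r" q'] by auto
    then have top: "rho (top z) = q'" using near_piece yz piece step by blast
    have cz: "c z = c y" using yz by simp
    show ?thesis
    proof (cases "z \<in> near E A (adh q') r")
      case True
      then show ?thesis using near_adh_sub[of r "3 * r" q'] by auto
    next
      case F: False
      show ?thesis
      proof (cases "c y")
        case True
        then have "y \<in> near E A (adh q') r" using IH by blast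
        \<comment> \<open>Outside the innermost band but within \<open>2 * r\<close> of the adhesion
          set, \<open>z\<close> would have colour \<open>False\<close>.\<close>
        then have "z \<in> near E A (adh q') (r + r)" by (rule near_step[OF _ yz(1)])
        then have "z \<in> near E A (X q' \<inter> A) (3 * r)"
          using near_adh_sub[of "r + r" "3 * r" q'] by auto
        then show ?thesis using c[of z] F top cz True by auto
      next
        case False
        \<comment> \<open>In the ball but beyond \<open>3 * r\<close>, \<open>z\<close> would have
          colour \<open>True\<close>.\<close>
        then show ?thesis using c[of z] F top cz z by (auto split: if_splits)
      qed
    qed
  qed
qed

text \<open>Take \<open>q\<close> of maximal depth. Depths are bounded because \<open>x\<close>
  itself is inside \<open>q\<close>, and a child piece with the whole component inside would
  contradict maximality.\<close>

lemma ex_lowest_piece: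
  assumes "x \<in> H"
  shows "\<exists>q. piece q \<and> (\<forall>y. (x, y) \<in> M\<^sup>* \<longrightarrow> inside q y) \<and>
    (\<forall>q'. child_piece q' q \<longrightarrow> (\<exists>y. (x, y) \<in> M\<^sup>* \<and> \<not> inside q' y))"
proof -
  let ?P = "\<lambda>q. piece q \<and> (\<forall>y. (x, y) \<in> M\<^sup>* \<longrightarrow> inside q y)"
  have "?P s" using piece_s by (auto simp: inside_def)
  moreover have "\<forall>q. ?P q \<longrightarrow> dep q < Suc (max (dep s) (dep (top x)))"
    using desc_dep(1) by (fastforce simp: inside_def less_Suc_eq_le)
  ultimately obtain q where q: "?P q" "\<And>p. ?P p \<Longrightarrow> dep p \<le> dep q"
    using ex_has_greatest_nat[of ?P s dep] by blast
  have "\<exists>y. (x, y) \<in> M\<^sup>* \<and> \<not> inside q' y" if q': "child_piece q' q" for q'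
    using q(2)[of q'] child_piece_desc(4)[OF q'] q' by (auto simp: child_piece_def)
  then show ?thesis using q by blast
qed

section \<open>Chains at the larger scale within one piece\<close>

definition Hat :: "'b \<Rightarrow> 'a set" where
  "Hat q = {h \<in> H. rho (top h) = q}"

abbreviation HM :: "'b \<Rightarrow> ('a \<times> 'a) set" where
  "HM q \<equiv> mono_step E A (Hat q) r' c"

lemma c_hat: "h \<in> Hat q \<Longrightarrow> h \<notin> ball q \<Longrightarrow> c h = cq q h"
  using c[of h] near_sub_ball[of "3 * r" q] near_adh_sub[of r "5 * r" q]
  by (auto simp: Hat_def ball_def)

text \<open>A step along a walk avoiding the ball is governed by \<open>cq q\<close>; any other step
  has both ends within \<open>r' + 5 * r\<close> of \<open>X q\<close>. A chain that meets this
  neighbourhood stays within \<open>D'\<close> of it, so it stays near few vertices and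
  \<open>chain_near_bounded\<close> applies.\<close>

lemma HM_bounded:
  assumes q: "piece q" and xy: "(x, y) \<in> (HM q)\<^sup>*" and x: "x \<in> Hat q"
  shows "dist_le E A (D' + cluster (Suc k) (r' + 5 * r + D') r') x y"
proof -
  define Hq where "Hq = (A - ball q) \<inter> (\<Union>t\<in>{t \<in> S. rho t = q}. X t)"
  define P where "P = mono_step E (A - ball q) Hq r' (cq q)"
  define N where "N = near E A (X q \<inter> A) (r' + 5 * r)"
  have ball_N: "b \<in> N" if "a \<in> ball q" "dist_le E A r' a b" for a b
    using near_step[OF that[unfolded ball_def]] by (simp add: N_def add.commute)
  have ball_sub: "ball q \<subseteq> N" unfolding ball_def N_def by (rule near_mono) simp
  have step: "(a, b) \<in> P \<or> (a \<in> N \<and> b \<in> N)" if ab: "(a, b) \<in> HM q" for a b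
  proof (cases "a \<in> ball q \<or> b \<in> ball q")
    case True
    then show ?thesis using ab ball_N ball_sub dist_le_sym[OF _ sym_E]
      by (auto simp: mono_step_def)
  next
    case False
    have ab': "a \<in> Hat q" "b \<in> Hat q" "c a = c b" "dist_le E A r' a b"
      using ab by (auto simp: mono_step_def)
    have "a \<in> Hq" "b \<in> Hq"
      using ab' False piece_bag[of a] piece_bag[of b] by (auto simp: Hq_def Hat_def H_def)
    then show ?thesis
      using dist_le_avoid[OF ab'(4) sym_E, of "ball q"] ab' False c_hat[of _ q] ball_N
      by (auto simp: P_def mono_step_def)
  qed
  have P_bound: "dist_le E A D' a b" if "(a, b) \<in> P\<^sup>*" "a \<in> A" for a b
  proof (cases "a = b")
    case True
    then show ?thesis using that by (auto intro: dist_le.refl)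
  next
    case False
    then have "a \<in> Hq" using that by (auto simp: P_def mono_step_def elim: converse_rtranclE)
    then have "dist_le E (A - ball q) D' a b"
      using cq[OF q] that by (auto simp: bounded_colouring_def P_def Hq_def)
    then show ?thesis by (rule dist_le_subset) auto
  qed
  have HatA: "Hat q \<subseteq> A" by (auto simp: Hat_def H_def)
  have sym: "sym (HM q)" by (rule sym_mono_step[OF sym_E])
  show ?thesis
  proof (cases "\<exists>g\<in>N. (x, g) \<in> (HM q)\<^sup>*")
    case False
    then have "(x, y) \<in> P\<^sup>*" using rtrancl_split_near[OF xy step] by blast
    then have "dist_le E A D' x y" using P_bound x HatA by blast
    then show ?thesis by (rule dist_le_mono) simp
  next
    case True
    then obtain g where g: "g \<in> N" "(x, g) \<in> (HM q)\<^sup>*" by blast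
    have near: "z \<in> near E A (X q \<inter> A) (r' + 5 * r + D')" if z: "(x, z) \<in> (HM q)\<^sup>*" for z
    proof -
      \<comment> \<open>Restarting the chain at \<open>g\<close> treats the vertices before and
        after \<open>g\<close> alike: each is reached from \<open>N\<close> by steps of
        \<open>P\<close>.\<close>
      have "(g, x) \<in> (HM q)\<^sup>*" using g(2) sym by (meson sym_rtrancl symD)
      then have "(g, z) \<in> (HM q)\<^sup>*" using z by simp
      from rtrancl_split_near[OF this step] obtain g' where "g' \<in> N" "(g', z) \<in> P\<^sup>*"
        using g by blast
      then show ?thesis
        using P_bound[of g' z] near_step[of g'] near_subset by (fastforce simp: N_def)
    qed
    have "(x, y) \<in> (chain_near E A (X q \<inter> A) (r' + 5 * r + D') r')\<^sup>*"
      using xy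
    proof (induction)
      case (step y z)
      then have "(y, z) \<in> chain_near E A (X q \<inter> A) (r' + 5 * r + D') r'"
        using near[of y] near[OF rtrancl_into_rtrancl[OF step.hyps]]
        by (simp add: chain_near_def mono_step_def)
      with step.IH show ?case by simp
    qed simp
    from chain_near_bounded[OF _ _ sym_E near[of x] this, of "Suc k"]
    have "dist_le E A (cluster (Suc k) (r' + 5 * r + D') r') x y"
      using bags[of q] q by (auto simp: piece_def)
    then show ?thesis by (rule dist_le_mono) simp
  qed
qed

end

text \<open>The piece \<open>q\<close> is the lowest one such that the monochromatic component of \<open>x0\<close> does
  not leave the part of the tree below it.\<close>

locale component_in_piece = piece_colouring +
  fixes x0 :: 'a and q :: 'b
  assumes x0: "x0 \<in> H" and q: "piece q"
    and comp_inside: "(x0, y) \<in> M\<^sup>* \<Longrightarrow> inside q y"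
    and comp_leaves: "child_piece q' q \<Longrightarrow> \<exists>y. (x0, y) \<in> M\<^sup>* \<and> \<not> inside q' y"
begin

section \<open>Shadowing a monochromatic component in the piece \<open>q\<close>\<close>

definition comp :: "'a set" where
  "comp = {y. (x0, y) \<in> M\<^sup>*}"

lemma comp_H: "comp \<subseteq> H"
  unfolding comp_def using mono_step_rtranclD(1)[OF _ x0] by blast

lemma comp_c: "y \<in> comp \<Longrightarrow> c y = c x0"
  unfolding comp_def using mono_step_rtranclD(2)[OF _ x0] by blast

lemma comp_connected: "y \<in> comp \<Longrightarrow> z \<in> comp \<Longrightarrow> (y, z) \<in> M\<^sup>*"
  unfolding comp_def
  using rtrancl_trans[OF symD[OF sym_rtrancl[OF sym_M]], of x0 y z] by blast

text \<open>The component has a vertex outside \<open>q'\<close>, from which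
  \<open>chain_inside\<close> can start.\<close>

lemma comp_near:
  assumes "y \<in> comp" "child_piece q' q" "inside q' y"
  shows "y \<in> near E A (X q' \<inter> A) (3 * r)" "rho (top y) = q'"
proof -
  obtain w where "w \<in> comp" "\<not> inside q' w" using comp_leaves assms by (auto simp: comp_def)
  then show *: "y \<in> near E A (X q' \<inter> A) (3 * r)"
    using chain_inside[OF assms(2) _ _ comp_connected assms(3)] assms(1) comp_H by blast
  then show "rho (top y) = q'"
    using near_sub_ball[of "3 * r" q'] near_piece assms comp_H by (auto simp: child_piece_def)
qed

lemma comp_cases:
  assumes "y \<in> comp" "rho (top y) \<noteq> q"
  shows "child_piece (rho (top y)) q" "inside (rho (top y)) y"
proof -
  obtain q' where "child_piece q' q" "inside q' y"
    using inside_child[of y q] assms comp_H comp_inside q by (auto simp: comp_def)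
  then show "child_piece (rho (top y)) q" "inside (rho (top y)) y"
    using comp_near assms by auto
qed

text \<open>A stand-in for \<open>y\<close> in the piece \<open>q\<close>, wanted at the vertices
  where a chain enters or leaves a child piece.\<close>

definition hat_of :: "'a \<Rightarrow> 'a \<Rightarrow> bool" where
  "hat_of y h \<longleftrightarrow> (if rho (top y) = q then h = y
     else h \<in> adh (rho (top y)) \<and> dist_le E A r h y \<and> c h = c y)"

text \<open>A step out of a child piece crosses its adhesion set, so \<open>y\<close> is in the
  innermost band and copies the colour of \<open>pi y\<close>.\<close>

lemma ex_hat:
  assumes "y \<in> comp" "z \<in> comp" "(y, z) \<in> M" "rho (top y) \<noteq> rho (top z) \<or> rho (top y) = q"
  shows "\<exists>h. hat_of y h"
proof (cases "rho (top y) = q")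
  case False
  have ne: "\<not> inside (rho (top y)) z"
    using comp_near(2)[OF assms(2) comp_cases(1)[OF assms(1) False]] assms False by auto
  have "dist_le E A r y z" using assms by (simp add: mono_step_def)
  from cross_adh[OF comp_cases[OF assms(1) False] ne this]
  have "y \<in> near E A (adh (rho (top y))) r" by (auto simp: near_def)
  then have "hat_of y (pi y)" using pi[of y] c[of y] False by (auto simp: hat_of_def)
  then show ?thesis by blast
qed (auto simp: hat_of_def)

lemma hat_props:
  assumes "y \<in> comp" "hat_of y h"
  shows "h \<in> Hat q" "c h = c x0" "dist_le E A r h y"
proof -
  show "c h = c x0" using comp_c assms by (auto simp: hat_of_def split: if_splits)
  show "dist_le E A r h y"
    using assms comp_H by (auto simp: hat_of_def H_def intro: dist_le.refl split: if_splits)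
  show "h \<in> Hat q"
    using assms comp_H comp_cases(1)[OF assms(1)] adh_hat
    by (cases "rho (top y) = q") (auto simp: hat_of_def Hat_def)
qed

abbreviation piece_chain :: "'b \<Rightarrow> ('a \<times> 'a) set" where
  "piece_chain p \<equiv> chain_near E A (X p \<inter> A) (3 * r) r"

text \<open>Unlike \<open>hat_of\<close>, this remembers the entry point of the chain while it
  wanders near the root bag of the child piece.\<close>

definition shadow :: "'a \<Rightarrow> 'a \<Rightarrow> bool" where
  "shadow h y \<longleftrightarrow> (if rho (top y) = q then h = y
     else h \<in> adh (rho (top y)) \<and> (h, y) \<in> (piece_chain (rho (top y)))\<^sup>*)"

lemma hat_chain:
  assumes "y \<in> comp" "hat_of y h" "rho (top y) \<noteq> q"
  shows "(h, y) \<in> piece_chain (rho (top y))" "(y, h) \<in> piece_chain (rho (top y))"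
proof -
  have "h \<in> X (rho (top y)) \<inter> A" "dist_le E A r h y"
    using assms adh_sub by (auto simp: hat_of_def)
  then show "(h, y) \<in> piece_chain (rho (top y))" "(y, h) \<in> piece_chain (rho (top y))"
    using comp_near(1)[OF assms(1) comp_cases[OF assms(1,3)]] dist_le_sym[OF _ sym_E]
    by (auto simp: chain_near_def near_self)
qed

lemma hat_shadow: "y \<in> comp \<Longrightarrow> hat_of y h \<Longrightarrow> shadow h y"
  using hat_chain(1) by (auto simp: shadow_def hat_of_def)

lemma shadow_bounded:
  assumes "y \<in> comp" "shadow h y"
  shows "dist_le E A (cluster (Suc k) (3 * r) r) h y"
proof (cases "rho (top y) = q")
  case True
  then show ?thesis using assms comp_H by (auto simp: shadow_def H_def intro: dist_le.refl)
next
  case False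
  then have h: "h \<in> X (rho (top y)) \<inter> A" "(h, y) \<in> (piece_chain (rho (top y)))\<^sup>*"
    using assms adh_sub by (auto simp: shadow_def)
  have "rho (top y) \<in> S" using comp_cases(1)[OF assms(1) False] child_piece_desc by blast
  then show ?thesis
    using chain_near_bounded[OF _ _ sym_E _ h(2), of "Suc k"] bags h by (auto simp: near_self)
qed

text \<open>Entry point \<open>h\<close> and exit point \<open>h'\<close> are joined by a chain near
  at most \<open>Suc k\<close> vertices, so their distance is at most the cluster bound contained in
  \<open>r'\<close>. Hence an excursion costs at most one step.\<close>

lemma shadow_hat:
  assumes "y \<in> comp" "shadow h y" "hat_of y h'" "c h = c x0"
  shows "h = h' \<or> (h, h') \<in> HM q"
proof (cases "rho (top y) = q")
  case True
  then show ?thesis using assms by (auto simp: shadow_def hat_of_def)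
next
  case False
  then have h: "h \<in> adh (rho (top y))" "(h, y) \<in> (piece_chain (rho (top y)))\<^sup>*"
    using assms by (auto simp: shadow_def)
  have "(h, h') \<in> (piece_chain (rho (top y)))\<^sup>*"
    using h(2) hat_chain(2)[OF assms(1,3) False] by simp
  moreover have "rho (top y) \<in> S" using comp_cases(1)[OF assms(1) False] child_piece_desc by blast
  moreover have "h \<in> X (rho (top y)) \<inter> A" using h adh_sub by blast
  ultimately have "dist_le E A (cluster (Suc k) (3 * r) r) h h'"
    using chain_near_bounded[OF _ _ sym_E, of "X (rho (top y)) \<inter> A" "Suc k" h A "3 * r" h' r] bags
    by (auto simp: near_self)
  then have "dist_le E A r' h h'" by (rule dist_le_mono) (simp add: r')
  then show ?thesis
    using adh_hat[OF comp_cases(1)[OF assms(1) False] h(1)] hat_props[OF assms(1,3)] assms(4)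
    by (auto simp: mono_step_def Hat_def)
qed

lemma shadow_step:
  assumes y: "y \<in> comp" and z: "z \<in> comp" and yz: "(y, z) \<in> M"
    and h0: "h0 \<in> Hat q" "c h0 = c x0" and h: "(h0, h) \<in> (HM q)\<^sup>*" "shadow h y"
  shows "\<exists>h'. (h0, h') \<in> (HM q)\<^sup>* \<and> shadow h' z"
proof (cases "rho (top y) = rho (top z) \<and> rho (top y) \<noteq> q")
  \<comment> \<open>While the chain moves inside one child piece, its shadow rests.\<close>
  case True
  define p where "p = rho (top y)"
  have p: "rho (top y) = p" "rho (top z) = p" "p \<noteq> q"
    unfolding p_def by (rule HOL.refl, rule conjunct1[OF True, symmetric], rule conjunct2[OF True])
  have "child_piece p q" "inside p y" "inside p z"
    using comp_cases[OF y] comp_cases[OF z] p by simp_all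
  then have "y \<in> near E A (X p \<inter> A) (3 * r)" "z \<in> near E A (X p \<inter> A) (3 * r)"
    using comp_near(1) y z by simp_all
  moreover have "dist_le E A r y z" using yz by (simp add: mono_step_def)
  ultimately have yz': "(y, z) \<in> piece_chain p" by (simp add: chain_near_def)
  have "h \<in> adh p" "(h, y) \<in> (piece_chain p)\<^sup>*"
    using h(2) p by (simp_all add: shadow_def)
  then have "shadow h z" using p rtrancl_into_rtrancl[OF _ yz'] by (simp add: shadow_def)
  then show ?thesis using h(1) by blast
next
  case False
  obtain hy where hy: "hat_of y hy" using ex_hat[OF y z yz] False by blast
  have "b \<noteq> a \<or> b = q" if "\<not> (a = b \<and> a \<noteq> q)" for a b using that by blast
  from this[OF False] have "rho (top z) \<noteq> rho (top y) \<or> rho (top z) = q" .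
  then obtain hz where hz: "hat_of z hz" using ex_hat[OF z y symD[OF sym_M yz]] by blast
  have "c h = c x0" using mono_step_rtranclD(2)[OF h(1) h0(1)] h0 by simp
  then have "h = hy \<or> (h, hy) \<in> HM q" by (rule shadow_hat[OF y h(2) hy])
  then have "(h0, hy) \<in> (HM q)\<^sup>*" using h(1) rtrancl_into_rtrancl[OF h(1)] by blast
  moreover have "(hy, hz) \<in> HM q"
  proof -
    have "dist_le E A r y z" using yz by (simp add: mono_step_def)
    \<comment> \<open>The route \<open>hy\<close>, \<open>y\<close>, \<open>z\<close>,
      \<open>hz\<close> has length at most \<open>3 * r\<close>, covered by the summand
      \<open>4 * r\<close> of \<open>r'\<close>.\<close>
    from dist_le_trans[OF dist_le_trans[OF hat_props(3)[OF y hy] this]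
        dist_le_sym[OF hat_props(3)[OF z hz] sym_E]]
    have "dist_le E A r' hy hz" by (rule dist_le_mono) (simp add: r')
    then show ?thesis using hat_props[OF y hy] hat_props[OF z hz] by (simp add: mono_step_def)
  qed
  ultimately have "(h0, hz) \<in> (HM q)\<^sup>*" by (rule rtrancl_into_rtrancl)
  then show ?thesis using hat_shadow[OF z hz] by blast
qed

text \<open>Without any hat no step could change the piece, and the component would stay in one
  child piece, which it is known to leave.\<close>

lemma ex_base: "\<exists>v\<in>comp. \<exists>h. hat_of v h"
proof (rule ccontr)
  assume no: "\<not> ?thesis"
  have x0c: "x0 \<in> comp" by (simp add: comp_def)
  have ne: "rho (top x0) \<noteq> q" using no x0c by (auto simp: hat_of_def)
  have same: "rho (top y) = rho (top x0)" if "(x0, y) \<in> M\<^sup>*" for y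
    using that
  proof (induction)
    case (step y z)
    then have "y \<in> comp" "z \<in> comp"
      using rtrancl_into_rtrancl[OF step.hyps] by (simp_all add: comp_def)
    moreover have "\<not> (\<exists>h. hat_of y h)" using no calculation(1) by blast
    ultimately have "rho (top y) = rho (top z)" using ex_hat[OF _ _ step.hyps(2)] by blast
    then show ?case using step.IH by simp
  qed simp
  obtain w where "w \<in> comp" "\<not> inside (rho (top x0)) w"
    using comp_leaves[OF comp_cases(1)[OF x0c ne]] by (auto simp: comp_def)
  moreover from this have w: "rho (top w) = rho (top x0)" using same[of w] by (simp add: comp_def)
  then have "rho (top w) \<noteq> q" using ne by simp
  ultimately show False using comp_cases(2)[of w] unfolding w by blast
qed

text \<open>Each vertex is reached from \<open>h0\<close> through its shadow; the factor 2 comes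
  from going via \<open>h0\<close>.\<close>

lemma comp_bounded:
  assumes "y \<in> comp"
  shows "dist_le E A (2 * (D' + cluster (Suc k) (r' + 5 * r + D') r'
    + cluster (Suc k) (3 * r) r)) x0 y"
proof -
  obtain v h0 where v: "v \<in> comp" "hat_of v h0" using ex_base by blast
  have h0: "h0 \<in> Hat q" "c h0 = c x0" using hat_props v by auto
  have sh: "\<exists>h. (h0, h) \<in> (HM q)\<^sup>* \<and> shadow h y" if y: "y \<in> comp" for y
  proof -
    have "(v, y) \<in> M\<^sup>*" using v y comp_connected by blast
    then show ?thesis
    proof (induction)
      case base
      show ?case using hat_shadow[OF v] by (intro exI[of _ h0]) simp
    next
      case (step y z)
      have "y \<in> comp" using step.hyps(1) v by (auto simp: comp_def)
      moreover from this have "z \<in> comp"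
        using rtrancl_into_rtrancl[OF _ step.hyps(2)] by (simp add: comp_def)
      moreover obtain h where "(h0, h) \<in> (HM q)\<^sup>*" "shadow h y" using step.IH by (elim exE conjE)
      ultimately show ?case by (rule shadow_step[OF _ _ step.hyps(2) h0])
    qed
  qed
  define D where "D = D' + cluster (Suc k) (r' + 5 * r + D') r' + cluster (Suc k) (3 * r) r"
  have D: "dist_le E A D h0 y" if "y \<in> comp" for y
  proof -
    from sh[OF that] obtain h where h: "(h0, h) \<in> (HM q)\<^sup>*" "shadow h y"
      by (elim exE conjE)
    show ?thesis
      using dist_le_trans[OF HM_bounded[OF q h(1) h0(1)] shadow_bounded[OF that h(2)]]
      by (simp add: D_def)
  qed
  have "x0 \<in> comp" by (simp add: comp_def)
  from dist_le_trans[OF dist_le_sym[OF D[OF this] sym_E] D[OF assms]]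
  show ?thesis unfolding D_def[symmetric] mult_2 .
qed

end

text \<open>\<open>K\<close> bounds an excursion into a child piece, \<open>r'\<close> is the scale
  inside pieces, and \<open>D'\<close> is the bound for bags that have lost a vertex. With empty
  bags there is nothing to colour, hence the value 0.\<close>

primrec diam_bound :: "nat \<Rightarrow> nat \<Rightarrow> nat" where
  "diam_bound 0 r = 0"
| "diam_bound (Suc k) r =
     (let K = cluster (Suc k) (3 * r) r; r' = K + 4 * r; D' = diam_bound k r'
      in 2 * (D' + cluster (Suc k) (r' + 5 * r + D') r' + K))"

lemma (in piece_colouring) bounded_c:
  assumes "D' = diam_bound k r'"
  shows "bounded_colouring E A H r (diam_bound (Suc k) r) c"
  unfolding bounded_colouring_def
proof (intro ballI allI impI)
  fix x y assume x: "x \<in> H" and y: "(x, y) \<in> M\<^sup>*"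
  obtain q where "piece q" "\<And>y. (x, y) \<in> M\<^sup>* \<Longrightarrow> inside q y"
    "\<And>q'. child_piece q' q \<Longrightarrow> \<exists>y. (x, y) \<in> M\<^sup>* \<and> \<not> inside q' y"
    using ex_lowest_piece[OF x] by blast
  with x interpret component_in_piece E T root par dep X top A S s k r rho r' D' c cq pi x q
    by unfold_locales
  show "dist_le E A (diam_bound (Suc k) r) x y"
    using comp_bounded[of y] y assms by (simp add: comp_def r' Let_def)
qed

context rooted_tree_decomposition
begin

text \<open>Induction on bag size with the other parameters general: a piece replaces them by
  \<open>A - ball q\<close>, its own nodes, its root and the scale \<open>r'\<close>.\<close>

theorem ex_bounded_colouring:
  assumes "s \<in> S" "S \<subseteq> T" "\<And>t. t \<in> S \<Longrightarrow> t \<noteq> s \<Longrightarrow> t \<noteq> root \<and> par t \<in> S"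
    "\<And>t. t \<in> S \<Longrightarrow> finite (X t \<inter> A) \<and> card (X t \<inter> A) \<le> k"
  shows "\<exists>c :: 'a \<Rightarrow> bool. bounded_colouring E A (A \<inter> (\<Union>t\<in>S. X t)) r (diam_bound k r) c"
  using assms
proof (induction k arbitrary: A S s r)
  case 0
  then have "X t \<inter> A = {}" if "t \<in> S" for t using that by fastforce
  then have "A \<inter> (\<Union>t\<in>S. X t) = {}" by auto
  then show ?case by (auto simp: bounded_colouring_def)
next
  case (Suc k)
  have "\<exists>rho. \<forall>t. rho t = (if t \<in> S \<and> t \<noteq> s
      then (if X t \<inter> near E A (X (rho (par t)) \<inter> A) (5 * r) = {} then t else rho (par t))
      else s)"
    by (rule ex_recursive_function[where m = dep and p = par and
          g = "\<lambda>t q. if X t \<inter> near E A (X q \<inter> A) (5 * r) = {} then t else q" and b = "\<lambda>_. s"])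
      (use Suc.prems par in blast)
  then obtain rho where rho: "\<And>t. rho t = (if t \<in> S \<and> t \<noteq> s
      then (if X t \<inter> near E A (X (rho (par t)) \<inter> A) (5 * r) = {} then t else rho (par t))
      else s)" by blast
  interpret subtree_pieces E T root par dep X top A S s k r rho
    by unfold_locales (rule Suc.prems rho | assumption)+
  define r' where "r' = cluster (Suc k) (3 * r) r + 4 * r"
  define Sq where "Sq q = {t \<in> S. rho t = q}" for q
  have "\<exists>c :: 'a \<Rightarrow> bool. bounded_colouring E (A - ball q)
      ((A - ball q) \<inter> (\<Union>t\<in>Sq q. X t)) r' (diam_bound k r') c" if q: "piece q" for q
  proof (rule Suc.IH)
    show "q \<in> Sq q" using q by (auto simp: piece_def Sq_def)
    show "Sq q \<subseteq> T" using Suc.prems by (auto simp: Sq_def)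
    show "t \<noteq> root \<and> par t \<in> Sq q" if "t \<in> Sq q" "t \<noteq> q" for t
      using that rho_par[of t] S_par[of t] by (auto simp: Sq_def)
    show "finite (X t \<inter> (A - ball q)) \<and> card (X t \<inter> (A - ball q)) \<le> k" if t: "t \<in> Sq q" for t
    proof -
      have fin: "finite (X t \<inter> A)" "card (X t \<inter> A) \<le> Suc k" using t bags by (auto simp: Sq_def)
      show ?thesis
      proof (cases "t = q")
        case True
        then have "X t \<inter> (A - ball q) = {}" using in_ball by auto
        then show ?thesis by simp
      next
        case False
        \<comment> \<open>A node other than the root stayed in the piece because its bag meets the
          ball; deleting the ball costs it a vertex.\<close>
        then have "X t \<inter> ball q \<noteq> {}" using t rho_par[of t] by (auto simp: Sq_def)
        then have "X t \<inter> (A - ball q) \<subset> X t \<inter> A"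
          using near_subset by (fastforce simp: ball_def)
        then have "card (X t \<inter> (A - ball q)) < card (X t \<inter> A)" "finite (X t \<inter> (A - ball q))"
          using psubset_card_mono[OF fin(1)] finite_subset[OF _ fin(1)] by (simp_all add: psubset_eq)
        then show ?thesis using fin(2) by simp
      qed
    qed
  qed
  then have "\<forall>q. \<exists>c :: 'a \<Rightarrow> bool. piece q \<longrightarrow> bounded_colouring E (A - ball q)
      ((A - ball q) \<inter> (\<Union>t\<in>Sq q. X t)) r' (diam_bound k r') c" by simp
  from choice[OF this] obtain cq :: "'t \<Rightarrow> 'a \<Rightarrow> bool" where
    "\<forall>q. piece q \<longrightarrow> bounded_colouring E (A - ball q)
      ((A - ball q) \<inter> (\<Union>t\<in>Sq q. X t)) r' (diam_bound k r') (cq q)" by (rule exE)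
  then have cq: "bounded_colouring E (A - ball q)
      ((A - ball q) \<inter> (\<Union>t\<in>Sq q. X t)) r' (diam_bound k r') (cq q)" if "piece q" for q
    using that by simp
  define near_adh where "near_adh v \<longleftrightarrow> v \<in> near E A (adh (rho (top v))) r" for v
  have "\<forall>v. \<exists>z. near_adh v \<longrightarrow> z \<in> adh (rho (top v)) \<and> dist_le E A r z v"
    by (auto simp: near_adh_def near_def)
  from choice[OF this] obtain pi where
    "\<forall>v. near_adh v \<longrightarrow> pi v \<in> adh (rho (top v)) \<and> dist_le E A r (pi v) v" by (rule exE)
  then have pi: "pi v \<in> adh (rho (top v)) \<and> dist_le E A r (pi v) v" if "near_adh v" for v
    using that by simp
  \<comment> \<open>The recursion for \<open>c\<close> is well-founded: \<open>pi v\<close> is in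
    the bag above the piece root, so its topmost node is strictly higher than that of
    \<open>v\<close>.\<close>
  have less: "dep (top (pi v)) < dep (top v)" if v: "near_adh v" for v
  proof -
    let ?q = "rho (top v)"
    have q: "?q \<noteq> s" "pi v \<in> X (par ?q)" using pi[OF v] by (auto simp: adh_def split: if_splits)
    then have v: "top v \<in> S" using rho_outside by blast
    then have "?q \<in> S" "desc ?q (top v)" using piece_rho by (auto simp: piece_def)
    then have "dep (par ?q) < dep ?q" "dep ?q \<le> dep (top v)" "par ?q \<in> T"
      using dep_par q desc_dep S_par S_sub by blast+
    then show ?thesis using desc_dep(1)[OF top_desc[of "par ?q" "pi v"]] q by simp
  qed
  have "\<exists>c. \<forall>v. c v = (if near_adh v then c (pi v) else
      (if v \<in> near E A (X (rho (top v)) \<inter> A) (3 * r) then False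
      else if v \<in> ball (rho (top v)) then True else cq (rho (top v)) v))"
    by (rule ex_recursive_function[where g = "\<lambda>_ z. z" and m = "\<lambda>v. dep (top v)"]) (rule less)
  then obtain c where c: "\<And>v. c v = (if near_adh v then c (pi v) else
      (if v \<in> near E A (X (rho (top v)) \<inter> A) (3 * r) then False
      else if v \<in> ball (rho (top v)) then True else cq (rho (top v)) v))" by blast
  interpret piece_colouring E T root par dep X top A S s k r rho r' "diam_bound k r'" c cq pi
    by unfold_locales
      (rule r'_def cq[unfolded Sq_def] c[unfolded near_adh_def] pi[unfolded near_adh_def]
        | assumption)+
  show ?case using bounded_c[OF HOL.refl] by (auto simp: H_def)
qed

end

section \<open>Three colours for bounded layered treewidth\<close>

text \<open>An even block has \<open>n\<close> layers and is thickened by \<open>n\<close> layers on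
  each side, so a bag meets it in at most \<open>(n + 2 * n) * w\<close> vertices.\<close>

definition even_bound :: "nat \<Rightarrow> nat \<Rightarrow> nat" where
  "even_bound w n = diam_bound ((n + 2 * n) * w) n"

text \<open>The length of an excursion from an odd block: a step out, a chain in an even block, a
  step back.\<close>

definition odd_scale :: "nat \<Rightarrow> nat \<Rightarrow> nat" where
  "odd_scale w n = 2 * n + even_bound w n"

definition odd_bound :: "nat \<Rightarrow> nat \<Rightarrow> nat" where
  "odd_bound w n = diam_bound ((n + 2 * odd_scale w n) * w) (odd_scale w n)"

definition layered_bound :: "nat \<Rightarrow> nat \<Rightarrow> nat" where
  "layered_bound w n = 2 * (odd_bound w n + n + even_bound w n)"

locale layered_tree_decomposition = rooted_tree_decomposition +
  fixes lay :: "'a \<Rightarrow> int" and w n :: nat and V :: "'a set"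
  assumes root_in: "root \<in> T" and n: "n > 0"
    and V: "V = (\<Union>t\<in>T. X t)"
    and lay_edge: "(u, v) \<in> E \<Longrightarrow> \<bar>lay u - lay v\<bar> \<le> 1"
    and fin_bag: "t \<in> T \<Longrightarrow> finite (X t)"
    and width: "t \<in> T \<Longrightarrow> card {v \<in> X t. lay v = i} \<le> w"
begin

definition scale :: "int \<Rightarrow> nat" where
  "scale m = (if even m then n else odd_scale w n)"

definition bound :: "int \<Rightarrow> nat" where
  "bound m = (if even m then even_bound w n else odd_bound w n)"

definition block :: "'a \<Rightarrow> int" where
  "block v = lay v div int n"

text \<open>The block is thickened by its own scale, so that walks of that length starting in the
  block do not leave the slab.\<close>

definition slab :: "int \<Rightarrow> 'a set" where
  "slab m = {v \<in> V. m * int n - int (scale m) \<le> lay v \<and> lay v < (m + 1) * int n + int (scale m)}"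

lemma lay_dist: "dist_le E A l u v \<Longrightarrow> \<bar>lay u - lay v\<bar> \<le> int l"
proof (induction rule: dist_le.induct)
  case (step l u v z)
  then show ?case using lay_edge[of v z] by auto
qed auto

lemma block_bounds: "block v * int n \<le> lay v" "lay v < (block v + 1) * int n"
proof -
  have "lay v = block v * int n + lay v mod int n" by (simp add: block_def)
  moreover have "0 \<le> lay v mod int n" "lay v mod int n < int n" using n by auto
  ultimately show "block v * int n \<le> lay v" "lay v < (block v + 1) * int n"
    by (auto simp: algebra_simps)
qed

text \<open>A block has \<open>n\<close> layers, and a walk of length \<open>n\<close> changes the
  layer by at most \<open>n\<close>.\<close>

lemma block_le:
  assumes "dist_le E A n u v"
  shows "block v \<le> block u + 1"
proof -
  have "lay v \<le> lay u + int n" using lay_dist[OF assms] by simp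
  then have "lay v div int n \<le> (lay u + int n) div int n" using n by (intro zdiv_mono1) auto
  also have "\<dots> = lay u div int n + 1" using n by simp
  finally show ?thesis by (simp add: block_def)
qed

lemma slab_dist:
  assumes "dist_le E V l u v" "l \<le> scale (block u)"
  shows "dist_le E (slab (block u)) l u v"
proof (rule dist_le_restrict[OF assms(1)])
  fix z assume z: "dist_le E V l u z"
  show "z \<in> slab (block u)"
    using lay_dist[OF z] dist_le_in[OF z] block_bounds[of u] assms(2) by (auto simp: slab_def)
qed

lemma slab_width:
  assumes "t \<in> T"
  shows "card (X t \<inter> slab m) \<le> (n + 2 * scale m) * w"
proof -
  let ?I = "{m * int n - int (scale m)..<(m + 1) * int n + int (scale m)}"
  have "card (X t \<inter> slab m) \<le> card (\<Union>i\<in>?I. {v \<in> X t. lay v = i})"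
    by (rule card_mono) (use fin_bag[OF assms] in \<open>auto simp: slab_def\<close>)
  also have "\<dots> \<le> (\<Sum>i\<in>?I. card {v \<in> X t. lay v = i})" by (rule card_UN_le) simp
  also have "\<dots> \<le> (\<Sum>i\<in>?I. w)" by (rule sum_mono) (rule width[OF assms])
  also have "card ?I = n + 2 * scale m" by (simp add: algebra_simps)
  then have "(\<Sum>i\<in>?I. w) = (n + 2 * scale m) * w" by simp
  finally show ?thesis .
qed

lemma ex_slab_colouring:
  "\<exists>c :: 'a \<Rightarrow> bool. bounded_colouring E (slab m) (slab m) (scale m) (bound m) c"
proof -
  have "\<exists>c :: 'a \<Rightarrow> bool. bounded_colouring E (slab m) (slab m \<inter> (\<Union>t\<in>T. X t))
      (scale m) (diam_bound ((n + 2 * scale m) * w) (scale m)) c"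
    by (rule ex_bounded_colouring[OF root_in]) (use par fin_bag slab_width in auto)
  moreover have "slab m \<inter> (\<Union>t\<in>T. X t) = slab m"
    unfolding V[symmetric] by (auto simp: slab_def)
  moreover have "diam_bound ((n + 2 * scale m) * w) (scale m) = bound m"
    by (simp add: bound_def scale_def even_bound_def odd_bound_def)
  ultimately show ?thesis by simp
qed

definition slab_col :: "int \<Rightarrow> 'a \<Rightarrow> bool" where
  "slab_col m = (SOME c. bounded_colouring E (slab m) (slab m) (scale m) (bound m) c)"

lemma slab_col: "bounded_colouring E (slab m) (slab m) (scale m) (bound m) (slab_col m)"
  unfolding slab_col_def by (rule someI_ex[OF ex_slab_colouring])

text \<open>Only the residue of \<open>height\<close> is a colour, but along monochromatic chains the height itself
  is constant, because each step changes it by at most 2.\<close>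

definition height :: "'a \<Rightarrow> int" where
  "height v = block v + of_bool (slab_col (block v) v)"

definition colour :: "'a \<Rightarrow> nat" where
  "colour v = nat (height v mod 3)"

text \<open>The height exceeds the block by 0 or 1, so equal heights put the blocks at most 1 apart,
  and parity makes them equal; the excess is then the slab colour.\<close>

lemma same_parity:
  assumes "height u = height v" "even (block u) = even (block v)"
  shows "block u = block v" "slab_col (block u) u = slab_col (block v) v"
proof -
  have "\<bar>block u - block v\<bar> \<le> 1"
    using assms(1) by (auto simp: height_def of_bool_def split: if_splits)
  with assms(2) show b: "block u = block v" by presburger
  show "slab_col (block u) u = slab_col (block v) v"
    using assms(1) b by (simp add: height_def of_bool_eq_iff)
qed

abbreviation M :: "('a \<times> 'a) set" where
  "M \<equiv> mono_step E V V n colour"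

lemma M_step:
  assumes "(u, v) \<in> M"
  shows "height u = height v" "dist_le E V n u v"
proof -
  show d: "dist_le E V n u v" using assms by (simp add: mono_step_def)
  have "block v \<le> block u + 1" "block u \<le> block v + 1"
    using block_le[OF d] block_le[OF dist_le_sym[OF d sym_E]] by auto
  moreover have "height u mod 3 = height v mod 3"
    using assms by (simp add: mono_step_def colour_def nat_eq_iff)
  moreover have "block u \<le> height u" "height u \<le> block u + 1"
      "block v \<le> height v" "height v \<le> block v + 1"
    by (auto simp: height_def)
  ultimately show "height u = height v" by presburger
qed

definition block_step :: "('a \<times> 'a) set" where
  "block_step = {(u, v). block u = block v \<and> height u = height v \<and> dist_le E V (scale (block u)) u v}"

lemma block_stepI:
  assumes "height u = height v" "even (block u) = even (block v)" "dist_le E V l u v"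
    "l \<le> scale (block u)"
  shows "(u, v) \<in> block_step"
  using assms same_parity(1)[OF assms(1,2)] dist_le_mono by (auto simp: block_step_def)

text \<open>A constant block and height fix the slab colour, so this is a monochromatic chain for
  the slab colouring.\<close>

lemma block_chain:
  assumes "(u, v) \<in> block_step\<^sup>*" "u \<in> V"
  shows "block v = block u" "height v = height u" "dist_le E V (bound (block u)) u v"
proof -
  define m where "m = block u"
  have "block v = m \<and> height v = height u \<and>
      (u, v) \<in> (mono_step E (slab m) (slab m) (scale m) (slab_col m))\<^sup>*"
    using assms(1)
  proof (induction)
    case (step v z)
    then have v: "block v = m" "height v = height u" "block z = m" "height z = height u"
        "dist_le E V (scale m) v z"
      by (auto simp: block_step_def)
    have d: "dist_le E (slab m) (scale m) v z" using slab_dist[OF v(5)] v by simp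
    have "slab_col m v = slab_col m z" using same_parity(2)[of v z] v by simp
    then have "(v, z) \<in> mono_step E (slab m) (slab m) (scale m) (slab_col m)"
      using d dist_le_in[OF d] by (simp add: mono_step_def)
    then show ?case using step.IH v by (auto intro: rtrancl_into_rtrancl)
  qed (simp add: m_def)
  moreover have "u \<in> slab m" using assms(2) block_bounds[of u] by (auto simp: slab_def m_def)
  ultimately show "block v = block u" "height v = height u" "dist_le E V (bound (block u)) u v"
    using slab_col[of m] dist_le_subset[of E "slab m" _ u v V]
    by (auto simp: bounded_colouring_def m_def slab_def)
qed

text \<open>An invariant: \<open>p\<close> is the last vertex seen in the odd block, and
  \<open>v\<close> is either \<open>p\<close> or on an excursion in an even block that began at
  \<open>e\<close>, next to \<open>p\<close>.\<close>

lemma chain_from_odd: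
  assumes "(u, v) \<in> M\<^sup>*" "u \<in> V" "odd (block u)"
  shows "\<exists>p. (u, p) \<in> block_step\<^sup>* \<and> height v = height u \<and>
    (v = p \<or> even (block v) \<and> (\<exists>e. dist_le E V n p e \<and> even (block e) \<and> (e, v) \<in> block_step\<^sup>*))"
  using assms(1)
proof (induction)
  case (step v z)
  then obtain p where p: "(u, p) \<in> block_step\<^sup>*" "height v = height u"
    and vp: "v = p \<or> even (block v) \<and>
      (\<exists>e. dist_le E V n p e \<and> even (block e) \<and> (e, v) \<in> block_step\<^sup>*)" by blast
  note vz = M_step[OF step.hyps(2)]
  have hp: "height p = height u" "odd (block p)" using block_chain[OF p(1) assms(2)] assms by auto
  have odd_scale: "n \<le> odd_scale w n" "n + even_bound w n + n \<le> odd_scale w n"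
    by (auto simp: odd_scale_def)
  from vp consider "v = p" | e where "even (block v)" "dist_le E V n p e" "even (block e)"
    "(e, v) \<in> block_step\<^sup>*" by blast
  then show ?case
  proof cases
    case 1
    show ?thesis
    proof (cases "even (block z)")
      case True
      then show ?thesis using p vz 1 by auto
    next
      case False
      then have "(p, z) \<in> block_step"
        using vz 1 hp odd_scale by (intro block_stepI[of _ _ n]) (auto simp: scale_def)
      then show ?thesis using rtrancl_into_rtrancl[OF p(1)] p vz by auto
    qed
  next
    case 2
    have e: "dist_le E V (even_bound w n) e v"
      using block_chain(3)[OF 2(4)] dist_le_in[OF 2(2)] 2 by (simp add: bound_def)
    show ?thesis
    proof (cases "even (block z)")
      case True
      then have "(v, z) \<in> block_step"
        using vz 2 by (intro block_stepI[of _ _ n]) (auto simp: scale_def)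
      then have "(e, z) \<in> block_step\<^sup>*" using 2(4) by simp
      then show ?thesis using p 2 vz True by metis
    next
      case False
      \<comment> \<open>The excursion ends: by the choice of \<open>odd_scale\<close>, the jump from
        \<open>p\<close> to \<open>z\<close> is one step of the odd block.\<close>
      have "dist_le E V (n + even_bound w n + n) p z"
        by (rule dist_le_trans[OF dist_le_trans[OF 2(2) e] vz(2)])
      then have "(p, z) \<in> block_step"
        using vz(1) p(2) hp odd_scale False
        by (intro block_stepI[of _ _ "n + even_bound w n + n"]) (auto simp: scale_def)
      then show ?thesis using rtrancl_into_rtrancl[OF p(1)] p vz by auto
    qed
  qed
qed auto

lemma odd_chain_bounded:
  assumes "(u, v) \<in> M\<^sup>*" "u \<in> V" "odd (block u)"
  shows "dist_le E V (odd_bound w n + n + even_bound w n) u v"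
proof -
  from chain_from_odd[OF assms] obtain p where p: "(u, p) \<in> block_step\<^sup>*"
    and vp: "v = p \<or> even (block v) \<and>
      (\<exists>e. dist_le E V n p e \<and> even (block e) \<and> (e, v) \<in> block_step\<^sup>*)" by blast
  have up: "dist_le E V (odd_bound w n) u p"
    using block_chain(3)[OF p assms(2)] assms by (simp add: bound_def)
  from vp show ?thesis
  proof (elim disjE conjE exE)
    assume "v = p"
    then show ?thesis using dist_le_mono[OF up] by simp
  next
    fix e assume e: "dist_le E V n p e" "even (block e)" "(e, v) \<in> block_step\<^sup>*"
    have "dist_le E V (even_bound w n) e v"
      using block_chain(3)[OF e(3)] dist_le_in[OF e(1)] e by (simp add: bound_def)
    from dist_le_trans[OF dist_le_trans[OF up e(1)] this] show ?thesis .
  qed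
qed

text \<open>If the component meets an odd block, both ends are measured from a vertex there, whence
  the factor 2; otherwise the chain stays in one even block.\<close>

theorem bounded_colour: "bounded_colouring E V V n (layered_bound w n) colour"
  unfolding bounded_colouring_def
proof (intro ballI allI impI)
  fix u v assume u: "u \<in> V" and uv: "(u, v) \<in> M\<^sup>*"
  show "dist_le E V (layered_bound w n) u v"
  proof (cases "\<exists>p. (u, p) \<in> M\<^sup>* \<and> odd (block p)")
    case True
    then obtain p where p: "(u, p) \<in> M\<^sup>*" "odd (block p)" by blast
    have pV: "p \<in> V" using mono_step_rtranclD(1)[OF p(1) u] .
    have pu: "(p, u) \<in> M\<^sup>*" by (rule symD[OF sym_rtrancl[OF sym_mono_step[OF sym_E]] p(1)])
    from dist_le_trans[OF dist_le_sym[OF odd_chain_bounded[OF pu pV p(2)] sym_E]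
        odd_chain_bounded[OF rtrancl_trans[OF pu uv] pV p(2)]]
    show ?thesis unfolding layered_bound_def mult_2 .
  next
    case False
    have "(u, v) \<in> block_step\<^sup>*"
      using uv
    proof (induction)
      case (step v z)
      then have "even (block v)" "even (block z)"
        using False rtrancl_into_rtrancl[OF step.hyps] by auto
      then have "(v, z) \<in> block_step"
        using M_step[OF step.hyps(2)] by (intro block_stepI[of _ _ n]) (auto simp: scale_def)
      then show ?case using step.IH by simp
    qed simp
    from block_chain(3)[OF this u] have "dist_le E V (even_bound w n) u v"
      using False by (auto simp: bound_def)
    then show ?thesis by (rule dist_le_mono) (simp add: layered_bound_def)
  qed
qed

lemma colour_less: "colour v < 3"
  by (simp add: colour_def nat_less_iff)

end

section \<open>Graphs, trees and layerings\<close>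

context pair_graph
begin

lemma sym_parcs: "sym (parcs G)"
  using sym_arcs by (simp add: symmetric_def)

lemma awalk_imp_dist_le: "awalk u p v \<Longrightarrow> dist_le (parcs G) (pverts G) (length p) u v"
proof (induction p arbitrary: u)
  case Nil
  then show ?case by (auto simp: awalk_Nil_iff intro: dist_le.refl)
next
  case (Cons e p)
  then have e: "e \<in> parcs G" "u = fst e" "awalk (snd e) p v" by (auto simp: awalk_Cons_iff)
  then have "dist_le (parcs G) (pverts G) (Suc 0) u (snd e)"
    using arc_fst_in_verts arc_snd_in_verts by (intro dist_le_edge) auto
  from dist_le_trans[OF this Cons.IH[OF e(3)]] show ?case by simp
qed

lemma dist_le_imp_awalk:
  "dist_le (parcs G) (pverts G) n u v \<Longrightarrow> \<exists>p. awalk u p v \<and> length p \<le> n"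
proof (induction rule: dist_le.induct)
  case (refl u n)
  then show ?case by (intro exI[of _ "[]"]) (simp add: awalk_Nil_iff)
next
  case (step n u v w)
  then obtain p where p: "awalk u p v" "length p \<le> n" by blast
  have "awalk v [(v, w)] w"
    using step by (simp add: awalk_Cons_iff awalk_Nil_iff)
  from awalk_appendI[OF p(1) this] show ?case using p(2) by (intro exI[of _ "p @ [(v, w)]"]) simp
qed

lemma unit_cost: "awalk_cost (\<lambda>_. 1) p = real (length p)"
  by (induction p) auto

lemma \<mu>_le_iff_dist_le:
  "\<mu> (\<lambda>_. 1) u v \<le> ereal r \<longleftrightarrow> (\<exists>n. real n \<le> r \<and> dist_le (parcs G) (pverts G) n u v)"
proof
  assume le: "\<mu> (\<lambda>_. 1) u v \<le> ereal r"
  show "\<exists>n. real n \<le> r \<and> dist_le (parcs G) (pverts G) n u v"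
  proof (rule ccontr)
    assume no: "\<not> ?thesis"
    \<comment> \<open>Lengths are integers, so those above \<open>r\<close> are at least
      \<open>m\<close>; this keeps the infimum above \<open>r\<close>, also when there is no walk at
      all.\<close>
    define m where "m = nat (\<lfloor>r\<rfloor> + 1)"
    have m: "real m > r" unfolding m_def by linarith
    have "real m \<le> real (length p)" if p: "awalk u p v" for p
    proof -
      have "real (length p) > r" using no awalk_imp_dist_le[OF p] by force
      then have "\<lfloor>r\<rfloor> < int (length p)" by (simp add: floor_less_iff)
      then show ?thesis by (simp add: m_def)
    qed
    then have "ereal (real m) \<le> \<mu> (\<lambda>_. 1) u v"
      unfolding \<mu>_def by (intro INF_greatest) (simp add: unit_cost)
    also note le
    finally show False using m by simp
  qed
next
  assume "\<exists>n. real n \<le> r \<and> dist_le (parcs G) (pverts G) n u v"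
  then obtain n where n: "real n \<le> r" "dist_le (parcs G) (pverts G) n u v" by blast
  then obtain p where p: "awalk u p v" "length p \<le> n" using dist_le_imp_awalk by blast
  have "\<mu> (\<lambda>_. 1) u v \<le> ereal (real (length p))"
    using min_cost_le_walk_cost[OF p(1), of "\<lambda>_. 1"] by (simp add: unit_cost)
  also have "\<dots> \<le> ereal r" using p n by simp
  finally show "\<mu> (\<lambda>_. 1) u v \<le> ereal r" .
qed

text \<open>A second path from \<open>a\<close> to \<open>b\<close>, closed up by the arc back, is a
  cycle. The path lacks the arc \<open>(a, b)\<close>, so it has at least two arcs and the cycle at
  least three.\<close>

lemma no_long_cycle_imp_bridge:
  assumes acyclic: "\<not> (\<exists>p. cycle p \<and> length p \<ge> 3)" and ab: "(a, b) \<in> parcs G"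
  shows "(a, b) \<notin> (parcs G - {(a, b), (b, a)})\<^sup>*"
proof
  assume path: "(a, b) \<in> (parcs G - {(a, b), (b, a)})\<^sup>*"
  define G' where "G' = \<lparr>pverts = pverts G, parcs = parcs G - {(a, b), (b, a)}\<rparr>"
  interpret G': pair_wf_digraph G'
    by unfold_locales (auto simp: G'_def dest: wellformed')
  have a: "a \<in> pverts G" and "a \<noteq> b" using ab wellformed' no_loops' by auto
  have "\<exists>p. G'.awalk a p b"
    using path
  proof (induction)
    case base
    have "a \<in> pverts G'" using a by (simp add: G'_def)
    then have "G'.awalk a [] a" by (simp add: G'.awalk_Nil_iff)
    then show ?case by blast
  next
    case (step y z)
    then obtain p where p: "G'.awalk a p y" by blast
    have "(y, z) \<in> parcs G'" using step by (simp add: G'_def)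
    then have "G'.awalk y [(y, z)] z"
      using G'.wellformed' by (simp add: G'.awalk_Cons_iff G'.awalk_Nil_iff)
    from G'.awalk_appendI[OF p this] show ?case by blast
  qed
  then obtain p where p: "G'.apath a p b" using G'.apath_awalk_to_apath by blast
  have "subgraph (with_proj G') (with_proj G)"
    by (auto simp: subgraph_def compatible_def G'_def intro: wf_digraph_axioms)
      (use G'.wf_digraph_axioms in \<open>simp add: G'_def\<close>)
  then have ap: "apath a p b" by (rule subgraph_apath_imp_apath[OF p])
  have "set p \<subseteq> parcs G'" using p by (auto simp: G'.apath_def G'.awalk_def)
  then have ab_notin: "(a, b) \<notin> set p" by (auto simp: G'_def)
  have "p \<noteq> []" using ap \<open>a \<noteq> b\<close> by (auto simp: apath_Nil_iff)
  moreover have "p \<noteq> [e]" for e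
    using ap ab_notin by (cases e) (auto simp: apath_def awalk_Cons_iff awalk_Nil_iff)
  ultimately have len: "length p \<ge> 2"
    by (cases p) (auto simp: Suc_le_eq)
  let ?c = "p @ [(b, a)]"
  have ba: "(b, a) \<in> parcs G" using ab sym_parcs by (auto dest: symD)
  have "awalk b [(b, a)] a" using ba a by (simp add: awalk_Cons_iff awalk_Nil_iff)
  then have c: "awalk a ?c a" using awalk_appendI ap by (auto simp: apath_def)
  have "cas a p b" "cas a ?c a" using ap c by (auto simp: apath_def awalk_def)
  then have "awalk_verts a p = a # map snd p" "awalk_verts a ?c = a # map snd ?c"
    using awalk_verts_conv'[of a p b] awalk_verts_conv'[of a ?c a] \<open>p \<noteq> []\<close> cas_simp[of p a b]
    by auto
  then have "distinct (tl (awalk_verts a ?c))" using ap by (auto simp: apath_def)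
  then have "cycle ?c" using c by (auto simp: cycle_def)
  moreover have "length ?c \<ge> 3" using len by simp
  ultimately show False using acyclic by blast
qed

end

section \<open>Rooting a tree-decomposition and numbering its layers\<close>

lemma reachable_restrict_imp_rtrancl:
  assumes "strongly_connected (with_proj T \<restriction> S)" "a \<in> S" "b \<in> S"
  shows "(a, b) \<in> (parcs T \<inter> S \<times> S)\<^sup>*"
proof -
  have "(a, b) \<in> rtrancl_on S (arcs_ends (with_proj T \<restriction> S))"
    using assms by (auto simp: strongly_connected_def reachable_def)
  then show ?thesis
  proof (induction rule: rtrancl_on_induct)
    case (step y z)
    then have "(y, z) \<in> parcs T \<inter> S \<times> S"
      by (auto simp: arcs_ends_def arc_to_ends_def induce_subgraph_def with_proj_def)
    then show ?case by (rule rtrancl_into_rtrancl[OF step.IH])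
  qed simp
qed

text \<open>Take \<open>dep\<close> as the distance from the root and \<open>par\<close> as a closer
  neighbour. An edge not between a node and its parent could be removed with both ends still joined
  to the root, so it would not be a bridge.\<close>

lemma ex_parent_function:
  fixes root :: 't
  assumes T: "graph_tree T" and root: "root \<in> pverts T"
  shows "\<exists>par dep. (\<forall>t\<in>pverts T. t \<noteq> root \<longrightarrow> par t \<in> pverts T \<and> dep (par t) < (dep t :: nat)) \<and>
    (\<forall>(a, b)\<in>parcs T. a \<noteq> root \<and> par a = b \<or> b \<noteq> root \<and> par b = a)"
proof -
  interpret pair_graph T using T by (simp add: graph_tree_def)
  have conn: "(root, t) \<in> (parcs T)\<^sup>*" if "t \<in> pverts T" for t
  proof -
    have "with_proj T \<restriction> pverts T = with_proj T"
      using wellformed' by (auto simp: induce_subgraph_def with_proj_def)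
    then have "(root, t) \<in> (parcs T \<inter> pverts T \<times> pverts T)\<^sup>*"
      using T that root
      by (intro reachable_restrict_imp_rtrancl) (auto simp: graph_tree_def)
    then show ?thesis using rtrancl_mono[of "parcs T \<inter> pverts T \<times> pverts T" "parcs T"] by blast
  qed
  define dep where "dep t = (LEAST n. (root, t) \<in> parcs T ^^ n)" for t
  have dep_le: "dep t \<le> n" if "(root, t) \<in> parcs T ^^ n" for t n
    unfolding dep_def using that by (rule Least_le)
  have dep: "(root, t) \<in> parcs T ^^ dep t" if "t \<in> pverts T" for t
    unfolding dep_def using conn[OF that] by (auto simp: rtrancl_power intro: LeastI)
  have "\<exists>p. (p, t) \<in> parcs T \<and> dep p < dep t" if t: "t \<in> pverts T" "t \<noteq> root" for t
  proof (cases "dep t")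
    case 0
    then show ?thesis using dep[OF t(1)] t by simp
  next
    case (Suc m)
    then obtain p where "(root, p) \<in> parcs T ^^ m" "(p, t) \<in> parcs T" using dep[OF t(1)] by auto
    then show ?thesis using dep_le[of p m] Suc by auto
  qed
  then have "\<forall>t. \<exists>p. t \<in> pverts T \<and> t \<noteq> root \<longrightarrow> (p, t) \<in> parcs T \<and> dep p < dep t" by blast
  from choice[OF this] obtain par where
    "\<forall>t. t \<in> pverts T \<and> t \<noteq> root \<longrightarrow> (par t, t) \<in> parcs T \<and> dep (par t) < dep t" by (rule exE)
  then have par: "(par t, t) \<in> parcs T" "dep (par t) < dep t" "par t \<in> pverts T"
    if "t \<in> pverts T" "t \<noteq> root" for t
    using that wellformed' by auto
  have "a \<noteq> root \<and> par a = b \<or> b \<noteq> root \<and> par b = a" if ab: "(a, b) \<in> parcs T" for a b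
  proof (rule ccontr)
    assume no: "\<not> ?thesis"
    let ?P = "parcs T - {(a, b), (b, a)}"
    have sym: "sym ?P" using sym_parcs by (auto simp: sym_def)
    have up: "(t, root) \<in> ?P\<^sup>*" if "t \<in> pverts T" for t
      using that
    proof (induction "dep t" arbitrary: t rule: less_induct)
      case less
      show ?case
      proof (cases "t = root")
        case False
        then have "(t, par t) \<in> ?P" using par[of t] no less.prems symD[OF sym_parcs] by auto
        moreover have "(par t, root) \<in> ?P\<^sup>*" using less par[of t] False by blast
        ultimately show ?thesis by (rule converse_rtrancl_into_rtrancl)
      qed simp
    qed
    have "a \<in> pverts T" "b \<in> pverts T" using ab wellformed' by auto
    then have "(a, root) \<in> ?P\<^sup>*" "(root, b) \<in> ?P\<^sup>*"
      using up symD[OF sym_rtrancl[OF sym]] by auto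
    then have "(a, b) \<in> ?P\<^sup>*" by (rule rtrancl_trans)
    then show False using no_long_cycle_imp_bridge[OF _ ab] T by (auto simp: graph_tree_def)
  qed
  then show ?thesis using par by (intro exI[of _ par] exI[of _ dep]) auto
qed

text \<open>Let \<open>top v\<close> minimise the depth among the nodes of \<open>v\<close>. A path
  from it to \<open>t\<close> in the subtree of \<open>v\<close> is converted into a purely upward
  path from \<open>t\<close>, whose first step gives \<open>bag_par\<close>.\<close>

lemma ex_rooted_tree_decomposition:
  assumes G: "pair_graph G" and td: "tree_decomposition G T X"
  shows "\<exists>root par dep top. root \<in> pverts T \<and>
    rooted_tree_decomposition (parcs G) (pverts T) root par dep X top"
proof -
  have T: "graph_tree T" using td by (simp add: tree_decomposition_def)
  then obtain root where root: "root \<in> pverts T"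
    by (auto simp: graph_tree_def strongly_connected_def with_proj_def)
  from ex_parent_function[OF T root] obtain par and dep :: "'b \<Rightarrow> nat" where pd:
    "(\<forall>t\<in>pverts T. t \<noteq> root \<longrightarrow> par t \<in> pverts T \<and> dep (par t) < dep t) \<and>
      (\<forall>(a, b)\<in>parcs T. a \<noteq> root \<and> par a = b \<or> b \<noteq> root \<and> par b = a)" by (elim exE)
  have par: "par t \<in> pverts T \<and> dep (par t) < dep t" if "t \<in> pverts T" "t \<noteq> root" for t
    using conjunct1[OF pd] that by simp
  have edge: "a \<noteq> root \<and> par a = b \<or> b \<noteq> root \<and> par b = a" if "(a, b) \<in> parcs T" for a b
    using bspec[OF conjunct2[OF pd] that] by simp
  define N where "N v = {t \<in> pverts T. v \<in> X t}" for v
  define top where "top v = arg_min dep (\<lambda>t. t \<in> N v)" for v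
  have top: "top v \<in> N v" "dep (top v) \<le> dep t" if t: "t \<in> N v" for t v
    using arg_min_nat_lemma[of "\<lambda>t. t \<in> N v" t dep, OF t] t unfolding top_def[symmetric] by simp_all
  have bag_par: "t \<noteq> root \<and> v \<in> X (par t)" if t: "t \<in> N v" "t \<noteq> top v" for t v
  proof -
    define U where "U = {(t, par t) | t. t \<in> N v \<and> t \<noteq> root \<and> par t \<in> N v}"
    have "v \<in> pverts G" using t td by (auto simp: N_def tree_decomposition_def)
    then have "strongly_connected (with_proj T \<restriction> N v)"
      using td by (simp add: tree_decomposition_def N_def)
    from reachable_restrict_imp_rtrancl[OF this top(1)[OF t(1)] t(1)]
    have "(t, top v) \<in> U\<^sup>*"
    proof (induction)
      case (step y z)
      then have yz: "y \<in> N v" "z \<in> N v" "(y, z) \<in> parcs T" by auto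
      from edge[OF yz(3)] show ?case
      proof (elim disjE conjE)
        assume "z \<noteq> root" "par z = y"
        then have "(z, y) \<in> U" using yz by (auto simp: U_def)
        then show ?thesis using step.IH by (rule converse_rtrancl_into_rtrancl)
      next
        \<comment> \<open>By minimality \<open>y\<close> is not the top, so the upward path from
          \<open>y\<close> already starts with the step to \<open>z\<close>, which is
          dropped.\<close>
        assume y: "y \<noteq> root" "par y = z"
        then have "dep z < dep y" using par[of y] yz by (auto simp: N_def)
        then have "y \<noteq> top v" using top(2)[OF yz(2)] by auto
        with step.IH obtain x where "(y, x) \<in> U" "(x, top v) \<in> U\<^sup>*"
          by (auto elim: converse_rtranclE)
        then show ?thesis using y by (auto simp: U_def)
      qed
    qed simp
    then obtain x where "(t, x) \<in> U" using t by (auto elim: converse_rtranclE)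
    then show ?thesis by (auto simp: U_def N_def)
  qed
  have "rooted_tree_decomposition (parcs G) (pverts T) root par dep X top"
  proof
    show "sym (parcs G)" by (rule pair_graph.sym_parcs[OF G])
    show "par t \<in> pverts T \<and> dep (par t) < dep t" if "t \<in> pverts T" "t \<noteq> root" for t
      using par that by blast
    show "top v \<in> pverts T \<and> v \<in> X (top v)" if "t \<in> pverts T" "v \<in> X t" for t v
      using top(1)[of t v] that by (simp add: N_def)
    show "t \<noteq> root \<and> v \<in> X (par t)" if "t \<in> pverts T" "v \<in> X t" "t \<noteq> top v" for t v
      using bag_par[of t v] that by (simp add: N_def)
    show "\<exists>t\<in>pverts T. u \<in> X t \<and> v \<in> X t" if "(u, v) \<in> parcs G" for u v
      using td that by (auto simp: tree_decomposition_def)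
  qed
  then show ?thesis using root by blast
qed

text \<open>The map \<open>f\<close> embeds the index type into the integers and respects
  successors, so both kinds of layering are treated at once.\<close>

lemma layering_imp_layer_function:
  fixes L :: "'i :: semiring_1 \<Rightarrow> 'a set" and f :: "'i \<Rightarrow> int"
  assumes L: "layering G L" "layered_width_at_most T X L w"
    and X: "\<And>t. t \<in> pverts T \<Longrightarrow> X t \<subseteq> pverts G"
    and f: "inj f" "\<And>i. f (i + 1) = f i + 1"
  shows "\<exists>lay. (\<forall>(u, v)\<in>parcs G. \<bar>lay u - lay v\<bar> \<le> (1 :: int)) \<and>
    (\<forall>t\<in>pverts T. \<forall>j. card {v \<in> X t. lay v = j} \<le> w)"
proof -
  have cover: "(\<Union>i. L i) = pverts G"
    and disj: "\<forall>i j. i \<noteq> j \<longrightarrow> L i \<inter> L j = {}"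
    and edge: "\<forall>(u, v)\<in>parcs G. \<exists>i. u \<in> L i \<union> L (i + 1) \<and> v \<in> L i \<union> L (i + 1)"
    using L(1) unfolding layering_def by simp_all
  define lay where "lay v = f (THE i. v \<in> L i)" for v
  have lay: "lay v = f i" if v: "v \<in> L i" for v i
  proof -
    have "j = i" if "v \<in> L j" for j using disj v that by blast
    then have "(THE i. v \<in> L i) = i" using v by (intro the_equality)
    then show ?thesis by (simp add: lay_def)
  qed
  have ex_layer: "\<exists>i. v \<in> L i" if "t \<in> pverts T" "v \<in> X t" for t v
    using X[OF that(1)] that(2) cover by blast
  have "\<bar>lay u - lay v\<bar> \<le> 1" if uv: "(u, v) \<in> parcs G" for u v
  proof -
    obtain i where "u \<in> L i \<union> L (i + 1)" "v \<in> L i \<union> L (i + 1)"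
      using bspec[OF edge uv] by auto
    then show ?thesis using lay f(2) by auto
  qed
  moreover have "card {v \<in> X t. lay v = j} \<le> w" if t: "t \<in> pverts T" for t j
  proof (cases "\<exists>v\<in>X t. lay v = j")
    case True
    then obtain v i where vi: "v \<in> L i" "lay v = j" using ex_layer[OF t] by blast
    have "u \<in> L i" if u: "u \<in> X t" "lay u = j" for u
    proof -
      obtain i' where i': "u \<in> L i'" using ex_layer[OF t u(1)] by blast
      have "f i' = f i" using lay[OF i'] lay[OF vi(1)] u vi by simp
      then show ?thesis using i' injD[OF f(1)] by blast
    qed
    then have "{v \<in> X t. lay v = j} = X t \<inter> L i" using lay[of _ i] lay[OF vi(1)] vi(2) by auto
    then show ?thesis using L(2) t by (simp add: layered_width_at_most_def)
  next
    case False
    then have empty: "{v \<in> X t. lay v = j} = {}" by blast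
    show ?thesis unfolding empty by simp
  qed
  ultimately show ?thesis by (intro exI[of _ lay]) auto
qed

section \<open>From layered width to covers of the graph\<close>

lemma has_layered_width_imp_colouring:
  assumes G: "pair_graph G" and w: "has_layered_width G w" and n: "n > 0"
  shows "\<exists>c :: 'a \<Rightarrow> nat. (\<forall>v. c v < 3) \<and>
    bounded_colouring (parcs G) (pverts G) (pverts G) n (layered_bound w n) c"
proof -
  from w obtain T :: "nat pair_pre_digraph" and X where td: "tree_decomposition G T X"
    and L: "(\<exists>L :: nat \<Rightarrow> 'a set. layering G L \<and> layered_width_at_most T X L w) \<or>
         (\<exists>L :: int \<Rightarrow> 'a set. layering G L \<and> layered_width_at_most T X L w)"
    unfolding has_layered_width_def by blast
  have X: "X t \<subseteq> pverts G" if "t \<in> pverts T" for t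
    using td that by (simp add: tree_decomposition_def)
  have "\<exists>lay. (\<forall>(u, v)\<in>parcs G. \<bar>lay u - lay v\<bar> \<le> (1 :: int)) \<and>
      (\<forall>t\<in>pverts T. \<forall>j. card {v \<in> X t. lay v = j} \<le> w)"
    using L
  proof (elim disjE exE conjE)
    fix L :: "nat \<Rightarrow> 'a set" assume "layering G L" "layered_width_at_most T X L w"
    from layering_imp_layer_function[OF this X, of int] show ?thesis by simp
  next
    fix L :: "int \<Rightarrow> 'a set" assume "layering G L" "layered_width_at_most T X L w"
    from layering_imp_layer_function[OF this X, of "\<lambda>i. i"] show ?thesis by simp
  qed
  then obtain lay where lay: "\<And>u v. (u, v) \<in> parcs G \<Longrightarrow> \<bar>lay u - lay v\<bar> \<le> (1 :: int)"
    "\<And>t j. t \<in> pverts T \<Longrightarrow> card {v \<in> X t. lay v = j} \<le> w" by blast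
  obtain root par dep top where root: "root \<in> pverts T"
    and rtd: "rooted_tree_decomposition (parcs G) (pverts T) root par dep X top"
    using ex_rooted_tree_decomposition[OF G td] by blast
  interpret G: pair_graph G by fact
  interpret rooted_tree_decomposition "parcs G" "pverts T" root par dep X top by fact
  interpret layered_tree_decomposition "parcs G" "pverts T" root par dep X top lay w n "pverts G"
  proof
    show "pverts G = (\<Union>t\<in>pverts T. X t)" using td by (simp add: tree_decomposition_def)
    show "finite (X t)" if "t \<in> pverts T" for t
      using finite_subset[OF X[OF that] G.pair_finite_verts] .
  qed (use root n lay in auto)
  show ?thesis using bounded_colour colour_less by blast
qed

text \<open>The monochromatic components at scale \<open>nat \<lceil>r\<rceil>\<close> are the
  members of the cover, with one family per colour; adding 1 makes the control function
  positive.\<close>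

lemma control_function_graph_space:
  assumes G: "pair_graph G"
    and col: "\<And>n. n > 0 \<Longrightarrow> \<exists>c :: 'a \<Rightarrow> nat. (\<forall>v. c v < 3) \<and>
      bounded_colouring (parcs G) (pverts G) (pverts G) n (b n) c"
  shows "control_function 2 (graph_space G) (\<lambda>r. real (b (nat \<lceil>r\<rceil>)) + 1)"
proof -
  interpret pair_graph G by fact
  let ?d = "\<mu> (\<lambda>_. 1)"
  have "\<exists>\<U> :: nat \<Rightarrow> 'a set set. \<Union> (\<Union>i\<in>{1..2 + 1}. \<U> i) = pverts G \<and>
      (\<forall>i\<in>{1..2 + 1}. disjoint_family_at ?d r (\<U> i)) \<and>
      bounded_family ?d (real (b (nat \<lceil>r\<rceil>)) + 1) (\<Union>i\<in>{1..2 + 1}. \<U> i)" if r: "r > 0" for r :: real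
  proof -
    define n where "n = nat \<lceil>r\<rceil>"
    have "n > 0" using r by (simp add: n_def)
    from col[OF this] obtain c :: "'a \<Rightarrow> nat" where c: "\<And>v. c v < 3"
      and bc: "bounded_colouring (parcs G) (pverts G) (pverts G) n (b n) c" by blast
    define M where "M = mono_step (parcs G) (pverts G) (pverts G) n c"
    define comp where "comp x = {y. (x, y) \<in> M\<^sup>*}" for x
    \<comment> \<open>Colours are 0, 1, 2, but families are numbered 1, 2, 3.\<close>
    define \<U> where "\<U> i = {comp x | x. x \<in> pverts G \<and> Suc (c x) = i}" for i
    have symM: "sym (M\<^sup>*)" unfolding M_def by (intro sym_rtrancl sym_mono_step sym_parcs)
    have comp: "y \<in> pverts G" "c y = c x" if "y \<in> comp x" "x \<in> pverts G" for x y
      using mono_step_rtranclD[of x y] that by (auto simp: comp_def M_def)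
    have comp_eq: "comp x = comp y" if "(x, y) \<in> M\<^sup>*" for x y
      using that symD[OF symM that] by (auto simp: comp_def intro: rtrancl_trans)
    have "\<Union> (\<Union>i\<in>{1..2 + 1}. \<U> i) = pverts G"
    proof (intro equalityI subsetI)
      fix x assume "x \<in> \<Union> (\<Union>i\<in>{1..2 + 1}. \<U> i)"
      then show "x \<in> pverts G" using comp by (auto simp: \<U>_def)
    next
      fix x assume x: "x \<in> pverts G"
      have "comp x \<in> \<U> (Suc (c x))" "x \<in> comp x" using x by (auto simp: \<U>_def comp_def)
      moreover have "Suc (c x) \<in> {1..2 + 1}" using c[of x] by auto
      ultimately show "x \<in> \<Union> (\<Union>i\<in>{1..2 + 1}. \<U> i)" by blast
    qed
    moreover have "disjoint_family_at ?d r (\<U> i)" for i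
      unfolding disjoint_family_at_def
    proof (intro ballI impI)
      fix A B x y assume AB: "A \<in> \<U> i" "B \<in> \<U> i" "A \<noteq> B" and xy: "x \<in> A" "y \<in> B"
      obtain a where a1: "A = comp a" "a \<in> pverts G" "Suc (c a) = i"
        using AB(1) unfolding \<U>_def by blast
      obtain a' where a2: "B = comp a'" "a' \<in> pverts G" "Suc (c a') = i"
        using AB(2) unfolding \<U>_def by blast
      have "c a = c a'" using a1 a2 by simp
      note a = a1(1) a2(1) a1(2) a2(2) this
      have xy': "x \<in> pverts G" "y \<in> pverts G" "c x = c y" using comp a xy by auto
      show "?d x y > ereal r"
      proof (rule ccontr)
        assume "\<not> ?thesis"
        then obtain m where m: "real m \<le> r" "dist_le (parcs G) (pverts G) m x y"
          using \<mu>_le_iff_dist_le[of x y r] by (auto simp: not_less)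
        have "m \<le> n" using m(1) unfolding n_def by linarith
        then have "(x, y) \<in> M" using dist_le_mono[OF m(2)] xy' by (auto simp: M_def mono_step_def)
        then have "comp x = comp y" by (intro comp_eq) auto
        moreover have "comp a = comp x" "comp a' = comp y"
          using a xy comp_eq by (auto simp: comp_def)
        ultimately show False using AB a by simp
      qed
    qed
    moreover have "bounded_family ?d (real (b n) + 1) (\<Union>i\<in>{1..2 + 1}. \<U> i)"
      unfolding bounded_family_def
    proof
      fix A assume "A \<in> (\<Union>i\<in>{1..2 + 1}. \<U> i)"
      then obtain a where a: "A = comp a" "a \<in> pverts G" by (auto simp: \<U>_def)
      have "?d x y \<le> ereal (real (b n) + 1)" if "x \<in> A" "y \<in> A" for x y
      proof -
        have "(x, y) \<in> M\<^sup>*" using that a symD[OF symM] by (auto simp: comp_def intro: rtrancl_trans)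
        moreover have "x \<in> pverts G" using comp that a by auto
        ultimately have "dist_le (parcs G) (pverts G) (b n) x y"
          using bc by (auto simp: bounded_colouring_def M_def)
        then show ?thesis unfolding \<mu>_le_iff_dist_le by (intro exI[of _ "b n"]) simp
      qed
      then show "set_diameter ?d A \<le> ereal (real (b n) + 1)"
        unfolding set_diameter_def by (intro SUP_least) auto
    qed
    ultimately show ?thesis by (intro exI[of _ \<U>]) (simp add: n_def)
  qed
  then show ?thesis by (auto simp: control_function_def graph_space_def)
qed

theorem theorem1p6:
  fixes w :: nat
  assumes "w > 0"
  shows "asymptotic_dimension
           (graph_space ` {G :: 'a pair_pre_digraph. pair_graph G \<and> layered_treewidth G \<le> w}) \<le> 2"
proof -
  \<comment> \<open>The bound depends only on \<open>w\<close> and \<open>r\<close>, so one function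
    serves the whole class.\<close>
  have "control_function 2 S (\<lambda>r. real (layered_bound w (nat \<lceil>r\<rceil>)) + 1)"
    if "S \<in> graph_space ` {G :: 'a pair_pre_digraph. pair_graph G \<and> layered_treewidth G \<le> w}" for S
    using that
    by (auto simp: layered_treewidth_le_iff
        intro!: control_function_graph_space has_layered_width_imp_colouring)
  then have "asymptotic_dimension
      (graph_space ` {G :: 'a pair_pre_digraph. pair_graph G \<and> layered_treewidth G \<le> w}) \<le> enat 2"
    unfolding asymptotic_dimension_def by (intro Inf_lower) blast
  then show ?thesis by (simp add: numeral_eq_enat)
qed

end
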